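(* Let $f_2(p)$ be as defined in the context. There exist absolute constants $C>0$ and $x_0>0$ such that for all real $x\ge x_0$, $$\sum_{p<x} f_2(p)\le C\, x\log^2 x\,\log\log x,$$ where the sum runs over prime numbers $p<x$.
   Context: For a positive integer $n$, let $f(n)$ denote the number of ordered triples $(n_1,n_2,n_3)$ of positive integers satisfying $\frac{4}{n}=\frac{1}{n_1}+\frac{1}{n_2}+\frac{1}{n_3}$. For a prime $p$, write $f(p)=f_1(p)+f_2(p)$, where $f_i(p)$ ($i=1,2$) is the number of such solutions $(n_1,n_2,n_3)$ of $\frac{4}{p}=\frac{1}{n_1}+\frac{1}{n_2}+\frac{1}{n_3}$ in which exactly $i$ of the denominators $n_1,n_2,n_3$ are divisible by $p$. *)

theory Defs
  imports "HOL-Analysis.Analysis"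
begin

definition sol_set :: "nat \<Rightarrow> (nat \<times> nat \<times> nat) set" where
  "sol_set n = {(n1, n2, n3). n1 > 0 \<and> n2 > 0 \<and> n3 > 0 \<and>
     (4::real) / real n = 1 / real n1 + 1 / real n2 + 1 / real n3}"

definition ndiv :: "nat \<Rightarrow> nat \<times> nat \<times> nat \<Rightarrow> nat" where
  "ndiv p t = (case t of (n1, n2, n3) \<Rightarrow>
     (if p dvd n1 then 1 else 0) + (if p dvd n2 then 1 else 0) + (if p dvd n3 then 1 else 0))"

definition f_i :: "nat \<Rightarrow> nat \<Rightarrow> nat" where
  "f_i i p = card {t \<in> sol_set p. ndiv p t = i}"

definition f2 :: "nat \<Rightarrow> nat" where
  "f2 p = f_i 2 p"

end

theory Submission
  imports Defs "HOL-Number_Theory.Number_Theory" "HOL-Computational_Algebra.Squarefree"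
begin

text \<open>
  A solution whose denominators divisible by \<open>p\<close> are the last two is
  \<open>(k b c, p k m b, p k m c)\<close> with \<open>b + c = m t\<close> and \<open>p + t = 4 k b c\<close>. If \<open>b \<le> c\<close>, this forces
  \<open>k b m t \<le> p\<close>, and eliminating \<open>c\<close> gives \<open>p = (4 k b m - 1) t - 4 k b^2\<close>. For fixed \<open>k, b, m\<close>
  with \<open>n = k b m\<close> one thus counts prime values of a linear polynomial in \<open>t \<le> x / n\<close>, and
  Selberg's sieve bounds their number by
  \<open>O(\<sigma>(q) (x / n) / (1 + log (x / n)))\<close> where \<open>q = 4 n - 1\<close> and
  \<open>\<sigma>(q)\<close> is the sum of the reciprocals of the divisors of \<open>q\<close>, a substitute for \<open>q / \<phi>(q)\<close>.

  By the symmetry between \<open>b\<close> and \<open>m\<close> one may assume \<open>b \<le> m\<close>. For fixed \<open>k, b\<close> and each divisor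
  \<open>d\<close> of \<open>q\<close>, \<open>m\<close> lies in one residue class modulo \<open>d\<close>, so the divisor sum costs only a constant
  factor, up to the contribution of the least element of the class, which is small because
  \<open>m \<ge> b\<close>. The sum over \<open>m\<close> of \<open>1 / (m (1 + log (y / m)))\<close> is \<open>O(log log y)\<close>, and the sums over \<open>k\<close>
  and \<open>b\<close> contribute a logarithm each.
\<close>

section \<open>Selberg's diagonalisation over a family of finite sets\<close>

text \<open>With \<open>A = E \<union> X\<close> the sum becomes, up to sign, the expansion of a
  product of factors \<open>-1 + 1\<close> over \<open>F - E\<close>, and that index set is empty
  only if \<open>E = F\<close>. This is Moebius inversion for finite sets.\<close>

lemma sum_minus_one_power_interval:
  assumes "finite F" "E \<subseteq> F"
  shows "(\<Sum>A | E \<subseteq> A \<and> A \<subseteq> F. (-1) ^ card A) = (if E = F then (-1) ^ card E else (0::real))"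
proof -
  have fin: "finite E" "finite (F - E)" using assms finite_subset by auto
  have "(\<Sum>A | E \<subseteq> A \<and> A \<subseteq> F. (-1) ^ card A) = (\<Sum>X\<in>Pow (F - E). (-1) ^ card (E \<union> X) :: real)"
    by (rule sum.reindex_bij_witness[of _ "\<lambda>X. E \<union> X" "\<lambda>A. A - E"])
      (use assms in \<open>auto simp: Un_absorb1\<close>)
  also have "\<dots> = (\<Sum>X\<in>Pow (F - E). (-1) ^ card E * ((\<Prod>x\<in>X. -1) * (\<Prod>x\<in>(F - E) - X. 1)))"
  proof (rule sum.cong)
    fix X assume X: "X \<in> Pow (F - E)"
    have "card (E \<union> X) = card E + card X"
      by (rule card_Un_disjoint) (use X fin finite_subset in auto)
    then show "(-1) ^ card (E \<union> X) = (-1) ^ card E * ((\<Prod>x\<in>X. -1) * (\<Prod>x\<in>(F - E) - X. 1::real))"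
      by (simp add: power_add)
  qed simp
  also have "\<dots> = (-1) ^ card E * (\<Prod>x\<in>F - E. -1 + (1::real))"
    by (simp only: prod_add[OF fin(2)] sum_distrib_left)
  also have "\<dots> = (if E = F then (-1) ^ card E else (0::real))"
    using assms fin by (auto simp: prod_zero_iff power_0_left)
  finally show ?thesis .
qed

text \<open>For \<open>g p = p\<close> and sets of primes read as squarefree numbers
  \<open>e\<close>, this is the classical sieve denominator, the sum of
  \<open>1 / phi(e)\<close>.\<close>

definition selberg_sum :: "'a set set \<Rightarrow> ('a \<Rightarrow> real) \<Rightarrow> real" where
  "selberg_sum D g = (\<Sum>E\<in>D. 1 / (\<Prod>p\<in>E. g p - 1))"

text \<open>The minimiser of the quadratic form \<open>\<Sum>A B. v A * v B / (\<Prod>p\<in>A \<union> B. g p)\<close> subject to \<open>v {} = 1\<close>.\<close>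
definition selberg_weight :: "'a set set \<Rightarrow> ('a \<Rightarrow> real) \<Rightarrow> 'a set \<Rightarrow> real" where
  "selberg_weight D g A = (-1) ^ card A * (\<Prod>p\<in>A. g p) / selberg_sum D g *
     (\<Sum>E\<in>{E\<in>D. A \<subseteq> E}. 1 / (\<Prod>p\<in>E. g p - 1))"

text \<open>Downward closure is the analogue of a divisor-closed set of squarefree moduli, and
  \<open>g p > 1\<close> makes the analogue \<open>g p - 1\<close> of Euler's function
  positive.\<close>

locale sieve_family =
  fixes D :: "'a set set" and g :: "'a \<Rightarrow> real"
  assumes finite_family: "finite D"
    and finite_member: "A \<in> D \<Longrightarrow> finite A"
    and subset_closed: "A \<in> D \<Longrightarrow> B \<subseteq> A \<Longrightarrow> B \<in> D"
    and empty_member: "{} \<in> D"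
    and weight_gt_1: "A \<in> D \<Longrightarrow> p \<in> A \<Longrightarrow> g p > 1"
begin

lemma totient_weight_pos: "A \<in> D \<Longrightarrow> (\<Prod>p\<in>A. g p - 1) > 0"
  by (rule prod_pos) (use weight_gt_1 in force)

lemma weight_prod_pos: "A \<in> D \<Longrightarrow> (\<Prod>p\<in>A. g p) > 0"
  by (rule prod_pos) (use weight_gt_1 in force)

lemma selberg_sum_pos: "selberg_sum D g > 0"
  unfolding selberg_sum_def
  by (rule sum_pos) (use finite_family empty_member totient_weight_pos in auto)

lemma selberg_weight_empty: "selberg_weight D g {} = 1"
  using selberg_sum_pos by (simp add: selberg_weight_def selberg_sum_def)

text \<open>The inner sum in \<open>selberg_weight\<close> runs over some of the positive terms of
  \<open>selberg_sum\<close>, so their quotient is at most 1.\<close>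

lemma abs_selberg_weight_le:
  assumes "A \<in> D"
  shows "\<bar>selberg_weight D g A\<bar> \<le> (\<Prod>p\<in>A. g p)"
proof -
  have "(\<Sum>E\<in>{E\<in>D. A \<subseteq> E}. 1 / (\<Prod>p\<in>E. g p - 1)) \<le> selberg_sum D g"
    unfolding selberg_sum_def
    by (rule sum_mono2) (use finite_family totient_weight_pos in \<open>auto intro: less_imp_le\<close>)
  moreover have "0 \<le> (\<Sum>E\<in>{E\<in>D. A \<subseteq> E}. 1 / (\<Prod>p\<in>E. g p - 1))"
    by (rule sum_nonneg) (use totient_weight_pos in \<open>auto intro: less_imp_le\<close>)
  ultimately have "(\<Prod>p\<in>A. g p) * (\<Sum>E\<in>{E\<in>D. A \<subseteq> E}. 1 / (\<Prod>p\<in>E. g p - 1))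
      \<le> (\<Prod>p\<in>A. g p) * selberg_sum D g"
    and "\<bar>selberg_weight D g A\<bar> =
      (\<Prod>p\<in>A. g p) * (\<Sum>E\<in>{E\<in>D. A \<subseteq> E}. 1 / (\<Prod>p\<in>E. g p - 1)) / selberg_sum D g"
    using weight_prod_pos[OF assms] selberg_sum_pos
    by (auto simp: selberg_weight_def abs_mult power_abs)
  then show ?thesis using selberg_sum_pos by (simp add: divide_le_eq)
qed

text \<open>After inserting the weights and swapping the sums, the inner sum over
  \<open>E \<subseteq> A \<subseteq> F\<close> alternates, and only \<open>F = E\<close> survives.
  These sums are the coordinates that diagonalise the quadratic form.\<close>

lemma sum_selberg_weight_supersets:
  assumes "E \<in> D"
  shows "(\<Sum>A\<in>{A\<in>D. E \<subseteq> A}. selberg_weight D g A / (\<Prod>p\<in>A. g p)) =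
    (-1) ^ card E / ((\<Prod>p\<in>E. g p - 1) * selberg_sum D g)"
proof -
  define S where "S = selberg_sum D g"
  have "(\<Sum>A\<in>{A\<in>D. E \<subseteq> A}. selberg_weight D g A / (\<Prod>p\<in>A. g p)) =
      (\<Sum>A\<in>{A\<in>D. E \<subseteq> A}. \<Sum>F\<in>{F\<in>D. A \<subseteq> F}. (-1) ^ card A / S / (\<Prod>p\<in>F. g p - 1))"
  proof (rule sum.cong)
    fix A assume "A \<in> {A\<in>D. E \<subseteq> A}"
    then have "(\<Prod>p\<in>A. g p) > 0" using weight_prod_pos by auto
    then have "selberg_weight D g A / (\<Prod>p\<in>A. g p) =
        ((-1) ^ card A / S) * (\<Sum>F\<in>{F\<in>D. A \<subseteq> F}. 1 / (\<Prod>p\<in>F. g p - 1))"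
      by (simp add: selberg_weight_def S_def)
    then show "selberg_weight D g A / (\<Prod>p\<in>A. g p) =
        (\<Sum>F\<in>{F\<in>D. A \<subseteq> F}. (-1) ^ card A / S / (\<Prod>p\<in>F. g p - 1))"
      by (simp only: sum_distrib_left times_divide_eq_right mult_1_right)
  qed simp
  also have "\<dots> = (\<Sum>A\<in>D. \<Sum>F\<in>D. if E \<subseteq> A \<and> A \<subseteq> F then (-1) ^ card A / S / (\<Prod>p\<in>F. g p - 1) else 0)"
    unfolding sum.inter_filter[OF finite_family] by (intro sum.cong refl) auto
  also have "\<dots> = (\<Sum>F\<in>D. \<Sum>A\<in>D. if E \<subseteq> A \<and> A \<subseteq> F then (-1) ^ card A / S / (\<Prod>p\<in>F. g p - 1) else 0)"
    by (rule sum.swap)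
  also have "\<dots> = (\<Sum>F\<in>D. if F = E then (-1) ^ card E / S / (\<Prod>p\<in>E. g p - 1) else 0)"
  proof (rule sum.cong)
    fix F assume F: "F \<in> D"
    have "(\<Sum>A\<in>D. if E \<subseteq> A \<and> A \<subseteq> F then (-1) ^ card A / S / (\<Prod>p\<in>F. g p - 1) else 0) =
        (\<Sum>A\<in>{A\<in>D. E \<subseteq> A \<and> A \<subseteq> F}. (-1) ^ card A / S / (\<Prod>p\<in>F. g p - 1))"
      by (rule sum.inter_filter[symmetric]) (rule finite_family)
    also have "{A\<in>D. E \<subseteq> A \<and> A \<subseteq> F} = {A. E \<subseteq> A \<and> A \<subseteq> F}"
      using F subset_closed by auto
    also have "(\<Sum>A | E \<subseteq> A \<and> A \<subseteq> F. (-1) ^ card A / S / (\<Prod>p\<in>F. g p - 1)) =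
        (\<Sum>A | E \<subseteq> A \<and> A \<subseteq> F. (-1) ^ card A) / S / (\<Prod>p\<in>F. g p - 1)"
      by (simp only: sum_divide_distrib)
    also have "\<dots> = (if F = E then (-1) ^ card E / S / (\<Prod>p\<in>E. g p - 1) else 0)"
    proof (cases "E \<subseteq> F")
      case True
      then show ?thesis
        using sum_minus_one_power_interval[OF finite_member[OF F] True] by auto
    next
      case False
      then have none: "{A. E \<subseteq> A \<and> A \<subseteq> F} = {}" by auto
      show ?thesis using False unfolding none by auto
    qed
    finally show "(\<Sum>A\<in>D. if E \<subseteq> A \<and> A \<subseteq> F then (-1) ^ card A / S / (\<Prod>p\<in>F. g p - 1) else 0) =
        (if F = E then (-1) ^ card E / S / (\<Prod>p\<in>E. g p - 1) else 0)" .
  qed simp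
  also have "\<dots> = (-1) ^ card E / ((\<Prod>p\<in>E. g p - 1) * S)"
    using assms finite_family by (simp add: mult.commute)
  finally show ?thesis unfolding S_def .
qed

text \<open>Splitting off the product over \<open>A \<inter> B\<close> and expanding it turns the
  form into a sum of squares with coefficients \<open>w E\<close>. The squares are known from
  \<open>sum_selberg_weight_supersets\<close>, and the total collapses to
  \<open>S / S\<^sup>2\<close>.\<close>

lemma selberg_quadratic_form:
  "(\<Sum>A\<in>D. \<Sum>B\<in>D. selberg_weight D g A * selberg_weight D g B / (\<Prod>p\<in>A \<union> B. g p)) =
    1 / selberg_sum D g"
proof -
  define S where "S = selberg_sum D g"
  define v where "v A = selberg_weight D g A / (\<Prod>p\<in>A. g p)" for A
  define w where "w E = (\<Prod>p\<in>E. g p - 1)" for E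
  have "(\<Sum>A\<in>D. \<Sum>B\<in>D. selberg_weight D g A * selberg_weight D g B / (\<Prod>p\<in>A \<union> B. g p)) =
      (\<Sum>A\<in>D. \<Sum>B\<in>D. \<Sum>E\<in>D. w E * ((if E \<subseteq> A then v A else 0) * (if E \<subseteq> B then v B else 0)))"
  proof (intro sum.cong refl)
    fix A B assume AB: "A \<in> D" "B \<in> D"
    have fin: "finite A" "finite B" using AB finite_member by auto
    have pos: "(\<Prod>p\<in>A. g p) > 0" "(\<Prod>p\<in>B. g p) > 0" using AB weight_prod_pos by auto
    have "(\<Prod>p\<in>A. g p) * (\<Prod>p\<in>B. g p) = (\<Prod>p\<in>A \<union> B. g p) * (\<Prod>p\<in>A \<inter> B. g p)"
      using prod.union_inter[OF fin, of g] by simp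
    moreover from this have "(\<Prod>p\<in>A \<union> B. g p) \<noteq> 0" using pos by auto
    ultimately have "selberg_weight D g A * selberg_weight D g B / (\<Prod>p\<in>A \<union> B. g p) =
        v A * v B * (\<Prod>p\<in>A \<inter> B. g p)"
      using pos unfolding v_def by (auto simp: divide_simps)
    \<comment> \<open>Expanding \<open>(g p - 1) + 1\<close> is the analogue of writing
      \<open>n\<close> as the sum of Euler's function over its divisors.\<close>
    also have "(\<Prod>p\<in>A \<inter> B. g p) = (\<Prod>p\<in>A \<inter> B. (g p - 1) + 1)" by simp
    also have "\<dots> = (\<Sum>E\<in>Pow (A \<inter> B). w E)"
      using fin by (subst prod_add) (auto simp: w_def)
    also have "Pow (A \<inter> B) = {E\<in>D. E \<subseteq> A \<inter> B}" using AB subset_closed by auto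
    also have "(\<Sum>E\<in>{E\<in>D. E \<subseteq> A \<inter> B}. w E) = (\<Sum>E\<in>D. if E \<subseteq> A \<inter> B then w E else 0)"
      by (rule sum.inter_filter) (rule finite_family)
    also have "v A * v B * \<dots> =
        (\<Sum>E\<in>D. w E * ((if E \<subseteq> A then v A else 0) * (if E \<subseteq> B then v B else 0)))"
      unfolding sum_distrib_left by (intro sum.cong refl) auto
    finally show "selberg_weight D g A * selberg_weight D g B / (\<Prod>p\<in>A \<union> B. g p) =
        (\<Sum>E\<in>D. w E * ((if E \<subseteq> A then v A else 0) * (if E \<subseteq> B then v B else 0)))" .
  qed
  also have "\<dots> = (\<Sum>A\<in>D. \<Sum>E\<in>D. \<Sum>B\<in>D. w E * ((if E \<subseteq> A then v A else 0) * (if E \<subseteq> B then v B else 0)))"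
    by (intro sum.cong refl sum.swap)
  also have "\<dots> = (\<Sum>E\<in>D. \<Sum>A\<in>D. \<Sum>B\<in>D. w E * ((if E \<subseteq> A then v A else 0) * (if E \<subseteq> B then v B else 0)))"
    by (rule sum.swap)
  also have "\<dots> = (\<Sum>E\<in>D. w E * (\<Sum>A\<in>D. if E \<subseteq> A then v A else 0)\<^sup>2)"
    unfolding power2_eq_square sum_product by (simp only: sum_distrib_left)
  also have "\<dots> = (\<Sum>E\<in>D. 1 / w E / S\<^sup>2)"
  proof (intro sum.cong refl)
    fix E assume E: "E \<in> D"
    have "(\<Sum>A\<in>D. if E \<subseteq> A then v A else 0) = (\<Sum>A\<in>{A\<in>D. E \<subseteq> A}. v A)"
      by (rule sum.inter_filter[symmetric]) (rule finite_family)
    also have "\<dots> = (-1) ^ card E / (w E * S)"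
      using sum_selberg_weight_supersets[OF E] by (simp add: v_def w_def S_def)
    also have "\<dots>\<^sup>2 = 1 / (w E)\<^sup>2 / S\<^sup>2"
      by (simp add: power_divide power_mult_distrib flip: power_mult)
    finally show "w E * (\<Sum>A\<in>D. if E \<subseteq> A then v A else 0)\<^sup>2 = 1 / w E / S\<^sup>2"
      using totient_weight_pos[OF E] by (simp add: w_def power2_eq_square)
  qed
  also have "\<dots> = S / S\<^sup>2" by (simp only: S_def selberg_sum_def w_def sum_divide_distrib)
  also have "\<dots> = 1 / S" by (simp add: power2_eq_square)
  finally show ?thesis unfolding S_def .
qed

end

section \<open>The Selberg sum of a family of primes\<close>

lemma sum_inverse_squares_le:
  assumes "finite X" "\<And>n. n \<in> X \<Longrightarrow> n > 0"
  shows "(\<Sum>n\<in>X. 1 / real n ^ 2) \<le> 2"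
proof -
  \<comment> \<open>The term \<open>1 / N\<close> is kept so that the induction telescopes.\<close>
  have upto: "(\<Sum>n=1..N. 1 / real n ^ 2) \<le> 2 - 1 / real N" if "N \<ge> 1" for N
    using that
  proof (induction N rule: nat_induct_at_least)
    case (Suc n)
    have "1 / real (Suc n) ^ 2 \<le> 1 / (real n * real (Suc n))"
      using Suc.hyps by (intro divide_left_mono) (auto simp: power2_eq_square)
    also have "\<dots> = 1 / real n - 1 / real (Suc n)"
      using Suc.hyps by (simp add: field_simps)
    finally show ?case using Suc.IH by simp
  qed simp
  have "(\<Sum>n\<in>X. 1 / real n ^ 2) \<le> (\<Sum>n=1..Max (insert 1 X). 1 / real n ^ 2)"
    using assms by (intro sum_mono2) (auto simp: Suc_le_eq)
  also have "\<dots> \<le> 2 - 1 / real (Max (insert 1 X))"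
    by (rule upto) (use assms in auto)
  also have "\<dots> \<le> 2" by simp
  finally show ?thesis .
qed

text \<open>For positive \<open>q\<close> this is the sum of the divisors of \<open>q\<close>
  divided by \<open>q\<close>. Being a sum over divisors, it can be averaged over \<open>q\<close>
  by interchanging summations.\<close>

definition sigma_inv :: "nat \<Rightarrow> real" where
  "sigma_inv q = (\<Sum>d | d dvd q. 1 / real d)"

lemma sigma_inv_ge_1: "q > 0 \<Longrightarrow> sigma_inv q \<ge> 1"
  unfolding sigma_inv_def using member_le_sum[of 1 "{d. d dvd q}" "\<lambda>d. 1 / real d"] by auto

text \<open>A finite set of primes encodes the squarefree number that is its product.\<close>
definition prime_family :: "nat \<Rightarrow> nat \<Rightarrow> nat set set" where
  "prime_family q R = {A. finite A \<and> (\<forall>p\<in>A. prime p \<and> \<not> p dvd q) \<and> \<Prod>A \<le> R}"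

lemma prime_family_finite:
  assumes "A \<in> prime_family q R" shows "finite A"
  using assms by (simp add: prime_family_def)

lemma prime_family_prime:
  assumes "A \<in> prime_family q R" "p \<in> A" shows "prime p" "\<not> p dvd q"
  using assms by (auto simp: prime_family_def)

lemma prime_set_prod_pos:
  assumes "\<forall>p\<in>A. prime (p::nat)" shows "\<Prod>A > 0"
  using assms by (auto intro!: prod_pos dest: prime_gt_0_nat)

lemma prime_factors_prime_set:
  assumes "finite A" "\<forall>p\<in>A. prime (p::nat)"
  shows "prime_factors (\<Prod>A) = A"
proof -
  have "p \<in> prime_factors (\<Prod>A) \<longleftrightarrow> p \<in> A" for p
  proof -
    have "p \<in> prime_factors (\<Prod>A) \<longleftrightarrow> prime p \<and> p dvd \<Prod>A"
      using prime_set_prod_pos[OF assms(2)] by (simp add: prime_factors_dvd)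
    also have "\<dots> \<longleftrightarrow> prime p \<and> (\<exists>x\<in>A. p dvd x)"
      using prime_dvd_prod_iff[OF assms(1), of p "\<lambda>x. x"] by auto
    also have "\<dots> \<longleftrightarrow> p \<in> A" using assms(2) by (auto dest: primes_dvd_imp_eq intro: bexI[of _ p])
    finally show ?thesis .
  qed
  then show ?thesis by blast
qed

lemma prime_family_inj: "inj_on (\<lambda>A. \<Prod>A) (prime_family q R)"
  by (rule inj_on_inverseI[where g = prime_factors])
    (simp add: prime_family_def prime_factors_prime_set)

lemma prime_family_image: "(\<lambda>A. \<Prod>A) ` prime_family q R \<subseteq> {1..R}"
proof (intro image_subsetI)
  fix A assume "A \<in> prime_family q R"
  then show "\<Prod>A \<in> {1..R}"
    using prime_set_prod_pos[of A] by (simp add: prime_family_def Suc_le_eq)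
qed

lemma finite_prime_family: "finite (prime_family q R)"
  using finite_imageD[OF finite_subset[OF prime_family_image] prime_family_inj] by simp

lemma card_prime_family_le: "card (prime_family q R) \<le> R"
  using card_inj_on_le[OF prime_family_inj prime_family_image] by simp

lemma sieve_family_prime_family:
  assumes "R \<ge> 1"
  shows "sieve_family (prime_family q R) real"
proof
  fix A B assume A: "A \<in> prime_family q R" and B: "B \<subseteq> A"
  have "finite B" using A B prime_family_finite finite_subset by blast
  have "\<Prod>B dvd \<Prod>A"
    using A B by (intro prod_dvd_prod_subset) (simp_all add: prime_family_def)
  then have "\<Prod>B \<le> \<Prod>A"
    using A prime_set_prod_pos[of A] by (intro dvd_imp_le) (simp_all add: prime_family_def)
  then show "B \<in> prime_family q R"
    using A B \<open>finite B\<close> unfolding prime_family_def by auto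
next
  show "{} \<in> prime_family q R" using assms by (simp add: prime_family_def)
next
  fix A p assume "A \<in> prime_family q R" "p \<in> A"
  then show "real p > 1" using prime_family_prime(1)[THEN prime_gt_1_nat] by simp
qed (fact finite_prime_family prime_family_finite)+

lemma squarefree_prod_prime_factors:
  assumes "squarefree (s::nat)"
  shows "\<Prod>(prime_factors s) = s"
proof -
  have prod_eq: "(\<Prod>p\<in>prime_factors s. p ^ multiplicity p s) = s"
    by (subst prod_prime_factors) (use assms in \<open>metis not_squarefree_0\<close>, simp)
  have mult1: "multiplicity p s = 1" if "p \<in> prime_factors s" for p
  proof -
    have "s \<noteq> 0" using assms by (metis not_squarefree_0)
    then have "multiplicity p s \<le> 1" "multiplicity p s > 0"
      using assms that squarefree_factorial_semiring''[of s]
      by (auto simp: prime_factors_multiplicity)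
    then show ?thesis by simp
  qed
  have "(\<Prod>p\<in>prime_factors s. p ^ multiplicity p s) = \<Prod>(prime_factors s)"
    by (intro prod.cong) (auto simp: mult1)
  with prod_eq show ?thesis by simp
qed

text \<open>Write \<open>n \<le> R\<close> as \<open>m^2 l r\<close> with \<open>l r\<close> squarefree and \<open>l = gcd (l r) q\<close>; then \<open>r\<close> is in the family.\<close>
lemma ln_le_sigma_inv_selberg_sum:
  assumes "q > 0" "R \<ge> 1"
  shows "ln (real R + 1) \<le> 2 * sigma_inv q * selberg_sum (prime_family q R) real"
proof -
  interpret sieve_family "prime_family q R" real
    by (rule sieve_family_prime_family) fact
  let ?D = "prime_family q R"
  let ?T = "{1..R} \<times> {d. d dvd q} \<times> ?D"
  let ?g = "\<lambda>(m,l,A). (1 / real m ^ 2) * ((1 / real l) * (1 / (\<Prod>p\<in>A. real p - 1)))"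
  have "ln (real R + 1) \<le> (\<Sum>n=1..R. 1 / real n)"
    using ln_le_harm[of R] by (simp add: harm_def inverse_eq_divide)
  also have "\<dots> \<le> (\<Sum>y\<in>?T. ?g y)"
  proof (rule sum_le_included[where i = "\<lambda>(m,l,A). m ^ 2 * l * \<Prod>A"])
    show "finite {1..R}" "finite ?T" using assms finite_family by auto
    show "\<forall>y\<in>?T. 0 \<le> ?g y"
      unfolding split_beta using totient_weight_pos
      by (intro ballI mult_nonneg_nonneg divide_nonneg_nonneg) (auto intro: less_imp_le)
    show "\<forall>n\<in>{1..R}. \<exists>y\<in>?T. (\<lambda>(m,l,A). m ^ 2 * l * \<Prod>A) y = n \<and> 1 / real n \<le> ?g y"
    proof
      fix n assume n: "n \<in> {1..R}"
      define m where "m = square_part n"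
      define s where "s = squarefree_part n"
      define l where "l = gcd s q"
      define r where "r = s div l"
      define A where "A = prime_factors r"
      have nms: "n = s * m ^ 2" unfolding m_def s_def by (rule squarefree_decompose)
      have slr: "s = l * r" unfolding r_def l_def by simp
      have sf: "squarefree s" by (simp add: s_def)
      have pos: "m > 0" "s > 0" "l > 0" "r > 0" using n nms slr by (auto intro!: Nat.gr0I)
      have "squarefree r" by (rule squarefree_mono[OF _ sf]) (simp add: slr)
      then have prodA: "\<Prod>A = r" unfolding A_def by (rule squarefree_prod_prime_factors)
      \<comment> \<open>Such a prime would divide both \<open>l\<close> and \<open>r\<close>, so its
        square would divide the squarefree \<open>s = l * r\<close>.\<close>
      have "\<not> p dvd q" if "p \<in> A" for p
      proof
        assume "p dvd q"
        have p: "prime p" "p dvd r" using that by (auto simp: A_def)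
        then have "p dvd l" unfolding l_def using \<open>p dvd q\<close> slr by (intro gcd_greatest) auto
        then have "p ^ 2 dvd s" using p slr by (auto simp: power2_eq_square intro: mult_dvd_mono)
        then have "p dvd 1" using sf squarefreeD by blast
        with p show False by auto
      qed
      moreover have "r \<le> n" unfolding nms slr using pos by simp
      ultimately have AD: "A \<in> ?D" using n prodA by (auto simp: prime_family_def A_def)
      have "m \<le> s * m ^ 2" using pos by (simp add: power2_eq_square)
      then have "m \<in> {1..R}" using nms n pos by simp
      moreover have "l dvd q" by (simp add: l_def)
      moreover have "m ^ 2 * l * \<Prod>A = n" by (simp add: prodA nms slr)
      moreover have "1 / real n \<le> ?g (m, l, A)"
      proof -
        \<comment> \<open>This is the bound of Euler's function of \<open>r\<close> by
          \<open>r\<close> itself.\<close>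
        have le: "(\<Prod>p\<in>A. real p - 1) \<le> real r"
          unfolding prodA[symmetric] of_nat_prod
          by (rule prod_mono) (use prime_family_prime[OF AD] prime_ge_1_nat in force)
        have "1 / real n = (1 / real m ^ 2) * ((1 / real l) * (1 / real r))"
          by (simp add: nms slr)
        also have "\<dots> \<le> (1 / real m ^ 2) * ((1 / real l) * (1 / (\<Prod>p\<in>A. real p - 1)))"
          using le totient_weight_pos[OF AD] pos by (intro mult_left_mono divide_left_mono) auto
        finally show ?thesis by simp
      qed
      ultimately show "\<exists>y\<in>?T. (\<lambda>(m,l,A). m ^ 2 * l * \<Prod>A) y = n \<and> 1 / real n \<le> ?g y"
        using AD by (intro bexI[of _ "(m, l, A)"]) auto
    qed
  qed
  also have "\<dots> = (\<Sum>m=1..R. 1 / real m ^ 2) * (sigma_inv q * selberg_sum ?D real)"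
    unfolding sigma_inv_def selberg_sum_def sum_product sum.cartesian_product
    by (simp add: split_beta)
  also have "\<dots> \<le> 2 * (sigma_inv q * selberg_sum ?D real)"
    using sum_inverse_squares_le[of "{1..R}"] sigma_inv_ge_1[OF assms(1)] selberg_sum_pos
    by (intro mult_right_mono) auto
  finally show ?thesis by (simp add: mult.assoc)
qed

text \<open>As \<open>q\<close> is invertible modulo \<open>d\<close>, the condition describes a
  single residue class, which is an arithmetic progression of difference \<open>d\<close> inside
  \<open>{1..N}\<close>.\<close>

lemma card_cong_class_bounds:
  fixes N d q c :: nat
  assumes "d > 0" "coprime q d"
  defines "K \<equiv> card {t\<in>{1..N}. [q * t = c] (mod d)}"
  shows "\<bar>real K - real N / real d\<bar> \<le> 1"
proof -
  obtain u where "[q * u = 1] (mod d)" using cong_solve_coprime_nat[OF assms(2)] by auto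
  then have u: "[q * (u * c) = c] (mod d)"
    using cong_scalar_right[of "q * u" 1 d c] by (simp add: mult.assoc)
  \<comment> \<open>The representative lies in \<open>1..d\<close> instead of \<open>0..d-1\<close>:
    since \<open>t\<close> starts at 1, \<open>r\<close> is then the first candidate in the
    class.\<close>
  define r where "r = (if (u * c) mod d = 0 then d else (u * c) mod d)"
  have r: "1 \<le> r" "r \<le> d" "[r = u * c] (mod d)"
    using assms(1) by (auto simp: r_def cong_def Suc_le_eq intro: less_imp_le)
  have iff: "[q * t = c] (mod d) \<longleftrightarrow> [t = r] (mod d)" for t
    using u r(3) cong_mult_lcancel_nat[OF assms(2), of t "u * c"] by (meson cong_sym cong_trans)
  show ?thesis
  proof (cases "r \<le> N")
    case True
    have "{t\<in>{1..N}. [q * t = c] (mod d)} = (\<lambda>j. r + d * j) ` {0..(N - r) div d}"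
    proof (intro equalityI subsetI)
      fix t assume "t \<in> {t\<in>{1..N}. [q * t = c] (mod d)}"
      then have t: "1 \<le> t" "t \<le> N" "[t = r] (mod d)" by (auto simp: iff)
      have "r \<le> t"
      proof (rule ccontr)
        assume "\<not> r \<le> t"
        then have "t < d" "t < r" using r by auto
        then have "r mod d = t" using t(3) by (simp add: cong_def)
        then show False using \<open>t < r\<close> r t(1) by (cases "r = d") auto
      qed
      then have "d dvd t - r" using t(3) cong_altdef_nat[of r t d] by blast
      then obtain j where "t - r = d * j" by auto
      then have "t = r + d * j" "j \<le> (N - r) div d"
        using \<open>r \<le> t\<close> t(2) assms(1) by (auto simp: less_eq_div_iff_mult_less_eq mult.commute)
      then show "t \<in> (\<lambda>j. r + d * j) ` {0..(N - r) div d}"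
        by (intro image_eqI[of _ _ j]) simp_all
    next
      fix t assume "t \<in> (\<lambda>j. r + d * j) ` {0..(N - r) div d}"
      then obtain j where "j \<in> {0..(N - r) div d}" and t: "t = r + d * j" by blast
      then have j: "j \<le> (N - r) div d" by simp
      then have "d * j \<le> N - r"
        using assms(1) by (simp add: less_eq_div_iff_mult_less_eq mult.commute)
      moreover have "[t = r] (mod d)" by (simp add: t cong_def)
      ultimately show "t \<in> {t\<in>{1..N}. [q * t = c] (mod d)}"
        using t r(1) True by (simp add: iff)
    qed
    moreover have "inj_on (\<lambda>j. r + d * j) {0..(N - r) div d}"
      using assms(1) by (auto simp: inj_on_def)
    ultimately have K: "K = (N - r) div d + 1" unfolding K_def by (simp add: card_image)
    have "real (N - r) = real d * real ((N - r) div d) + real ((N - r) mod d)"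
      by (simp flip: of_nat_mult of_nat_add)
    moreover have "real ((N - r) mod d) < real d" using assms(1) by simp
    ultimately have "real ((N - r) div d) \<le> real (N - r) / real d"
      and "real (N - r) / real d - real ((N - r) div d) \<le> 1"
      using assms(1) by (auto simp: field_simps)
    moreover have "real (N - r) / real d \<le> real N / real d"
      by (intro divide_right_mono) auto
    moreover have "real N / real d - 1 \<le> real (N - r) / real d"
      using True r assms(1) by (simp add: field_simps of_nat_diff)
    ultimately show ?thesis unfolding K by simp
  next
    case False
    have "{t\<in>{1..N}. [q * t = c] (mod d)} = {}"
    proof -
      have False if t: "1 \<le> t" "t \<le> N" "[t = r] (mod d)" for t
      proof -
        have "t < d" "t < r" using False r t by auto
        then have "r mod d = t" using t(3) by (simp add: cong_def)
        then show False using \<open>t < r\<close> r t(1) by (cases "r = d") auto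
      qed
      then show ?thesis unfolding iff by auto
    qed
    then have "K = 0" by (simp add: K_def)
    moreover have "real N / real d \<le> 1" using False r by (simp add: divide_le_eq)
    ultimately show ?thesis by simp
  qed
qed

section \<open>Prime values of a linear polynomial\<close>

lemma prime_family_cong_iff:
  assumes "A \<in> prime_family q R"
  shows "[x = y] (mod \<Prod>A) \<longleftrightarrow> (\<forall>p\<in>A. [x = y] (mod p))"
proof
  assume "[x = y] (mod \<Prod>A)"
  then show "\<forall>p\<in>A. [x = y] (mod p)"
    using dvd_prodI[OF prime_family_finite[OF assms], of _ "\<lambda>p. p"] cong_dvd_modulus_nat by blast
next
  assume "\<forall>p\<in>A. [x = y] (mod p)"
  then show "[x = y] (mod \<Prod>A)"
    using prime_family_prime(1)[OF assms] by (intro coprime_cong_prod_nat primes_coprime) auto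
qed

lemma prime_family_coprime:
  assumes "A \<in> prime_family q R"
  shows "coprime q (\<Prod>A)"
  using prime_family_prime[OF assms]
  by (intro prod_coprime_right) (simp add: coprime_commute prime_imp_coprime)

text \<open>The error term \<open>R^4\<close> instead of the usual \<open>R^2\<close> comes from using only the trivial bound on
  the sieve weights; it is harmless because \<open>R\<close> is later taken to be \<open>N powr (1/8)\<close>.\<close>
lemma card_prime_values_le:
  fixes q c N R :: nat
  assumes q: "q > 0" and R: "R \<ge> 1" and T: "T \<subseteq> {1..N}"
    and prime_value: "\<And>t. t \<in> T \<Longrightarrow> \<exists>p. prime p \<and> p + c = q * t"
  shows "real (card T) \<le> real N / selberg_sum (prime_family q R) real + real R ^ 4 + real R"
proof -
  interpret sieve_family "prime_family q R" real
    by (rule sieve_family_prime_family) fact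
  let ?D = "prime_family q R"
  define lam where "lam = selberg_weight ?D real"
  define ev where "ev A t \<longleftrightarrow> (\<forall>p\<in>A. [q * t = c] (mod p))" for A t
  have finT: "finite T" using T finite_subset by blast
  \<comment> \<open>A prime value up to \<open>R\<close> may belong to a member of the family and
    would be sieved out, so such values are counted separately; there are at most \<open>R\<close>
    of them.\<close>
  define T1 where "T1 = {t\<in>T. q * t - c \<le> R}"
  define T2 where "T2 = {t\<in>T. q * t - c > R}"
  have T_split: "card T = card T1 + card T2"
  proof -
    have "T = T1 \<union> T2" by (auto simp: T1_def T2_def)
    moreover have "card (T1 \<union> T2) = card T1 + card T2"
      using finT by (intro card_Un_disjoint) (auto simp: T1_def T2_def)
    ultimately show ?thesis by simp
  qed
  have prime_val: "prime (q * t - c)" "c \<le> q * t" if "t \<in> T" for t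
    using prime_value[OF that] by (metis add_diff_cancel_right' le_add2)+
  have "inj_on (\<lambda>t. q * t - c) T1"
  proof (rule inj_onI)
    fix s t assume st: "s \<in> T1" "t \<in> T1" "q * s - c = q * t - c"
    then have "c \<le> q * s" "c \<le> q * t" by (auto simp: T1_def prime_val(2))
    then have "q * s = q * t" using st(3) by linarith
    then show "s = t" using q by simp
  qed
  moreover have "(\<lambda>t. q * t - c) ` T1 \<subseteq> {1..R}"
    using prime_val(1) prime_ge_1_nat by (auto simp: T1_def)
  ultimately have T1: "card T1 \<le> R" using card_inj_on_le[of _ T1 "{1..R}"] by simp
  \<comment> \<open>A prime value above \<open>R\<close> is divisible by no prime of any member of
    the family, so only the empty set contributes, with weight 1.\<close>
  have detect: "(\<Sum>A\<in>?D. if ev A t then lam A else 0) = 1" if t: "t \<in> T2" for t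
  proof -
    define p where "p = q * t - c"
    have p: "prime p" "p > R" "q * t = p + c"
      using prime_val[of t] t by (auto simp: T2_def p_def)
    have "ev A t \<longleftrightarrow> A = {}" if A: "A \<in> ?D" for A
    proof
      assume "ev A t"
      show "A = {}"
      proof (rule ccontr)
        assume "A \<noteq> {}"
        then obtain r where r: "r \<in> A" by auto
        have "[p + c = c] (mod r)" using \<open>ev A t\<close> r p(3) by (simp add: ev_def)
        then have "r dvd p" by (simp add: cong_add_rcancel_0_nat cong_0_iff)
        then have "r = p" using p(1) prime_family_prime(1)[OF A r] by (intro primes_dvd_imp_eq)
        moreover have "r \<le> \<Prod>A"
        proof (rule dvd_imp_le)
          show "r dvd \<Prod>A" by (rule dvd_prodI[OF prime_family_finite[OF A] r])
          show "\<Prod>A > 0" by (rule prime_set_prod_pos) (use prime_family_prime[OF A] in simp)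
        qed
        moreover have "\<Prod>A \<le> R" using A by (simp add: prime_family_def)
        ultimately show False using p(2) by simp
      qed
    qed (simp add: ev_def)
    then have "(\<Sum>A\<in>?D. if ev A t then lam A else 0) = (\<Sum>A\<in>?D. if A = {} then lam A else 0)"
      by (intro sum.cong) auto
    also have "\<dots> = 1" using empty_member finite_family selberg_weight_empty by (simp add: lam_def)
    finally show ?thesis .
  qed
  \<comment> \<open>The square equals 1 on \<open>T2\<close> and is nonnegative elsewhere, so the
    sum may be extended to all \<open>t \<le> N\<close>.\<close>
  have "real (card T2) = (\<Sum>t\<in>T2. (\<Sum>A\<in>?D. if ev A t then lam A else 0)\<^sup>2)"
    by (simp add: detect)
  also have "\<dots> \<le> (\<Sum>t\<in>{1..N}. (\<Sum>A\<in>?D. if ev A t then lam A else 0)\<^sup>2)"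
    using T by (intro sum_mono2) (auto simp: T2_def)
  also have "\<dots> = (\<Sum>t\<in>{1..N}. \<Sum>A\<in>?D. \<Sum>B\<in>?D.
      (if ev A t then lam A else 0) * (if ev B t then lam B else 0))"
    unfolding power2_eq_square sum_product ..
  also have "\<dots> = (\<Sum>A\<in>?D. \<Sum>t\<in>{1..N}. \<Sum>B\<in>?D.
      (if ev A t then lam A else 0) * (if ev B t then lam B else 0))"
    by (rule sum.swap)
  also have "\<dots> = (\<Sum>A\<in>?D. \<Sum>B\<in>?D. \<Sum>t\<in>{1..N}.
      (if ev A t then lam A else 0) * (if ev B t then lam B else 0))"
    by (intro sum.cong refl sum.swap)
  also have "\<dots> \<le> (\<Sum>A\<in>?D. \<Sum>B\<in>?D.
      real N * (lam A * lam B / (\<Prod>p\<in>A \<union> B. real p)) + \<bar>lam A\<bar> * \<bar>lam B\<bar>)"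
  proof (intro sum_mono)
    fix A B assume AB: "A \<in> ?D" "B \<in> ?D"
    \<comment> \<open>The product over the union may exceed \<open>R\<close>, so the bound of the
      family is raised to that product; coprimality to \<open>q\<close> and the Chinese remainder
      theorem remain available.\<close>
    have AB_fam: "A \<union> B \<in> prime_family q (\<Prod>(A \<union> B))"
      using AB by (auto simp: prime_family_def)
    define K where "K = card {t\<in>{1..N}. [q * t = c] (mod \<Prod>(A \<union> B))}"
    have "(\<Sum>t\<in>{1..N}. (if ev A t then lam A else 0) * (if ev B t then lam B else 0)) =
        (\<Sum>t\<in>{1..N}. if [q * t = c] (mod \<Prod>(A \<union> B)) then lam A * lam B else 0)"
      unfolding prime_family_cong_iff[OF AB_fam] ev_def by (intro sum.cong) auto
    also have "\<dots> = (\<Sum>t\<in>{t\<in>{1..N}. [q * t = c] (mod \<Prod>(A \<union> B))}. lam A * lam B)"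
      by (rule sum.inter_filter[symmetric]) simp
    also have "\<dots> = lam A * lam B * real K" by (simp add: K_def)
    finally have eq: "(\<Sum>t\<in>{1..N}. (if ev A t then lam A else 0) * (if ev B t then lam B else 0)) =
        lam A * lam B * real K" .
    have "\<bar>real K - real N / real (\<Prod>(A \<union> B))\<bar> \<le> 1"
      unfolding K_def
      by (rule card_cong_class_bounds[OF _ prime_family_coprime[OF AB_fam]],
          rule prime_set_prod_pos) (use prime_family_prime[OF AB_fam] in simp)
    then have "\<bar>lam A * lam B\<bar> * \<bar>real K - real N / real (\<Prod>(A \<union> B))\<bar> \<le> \<bar>lam A * lam B\<bar> * 1"
      by (rule mult_left_mono) simp
    then have diff: "\<bar>lam A * lam B * real K - lam A * lam B * (real N / real (\<Prod>(A \<union> B)))\<bar>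
        \<le> \<bar>lam A\<bar> * \<bar>lam B\<bar>"
      by (simp only: abs_mult[symmetric] right_diff_distrib mult_1_right)
    have main: "lam A * lam B * (real N / real (\<Prod>(A \<union> B))) =
        real N * (lam A * lam B / (\<Prod>p\<in>A \<union> B. real p))" by simp
    show "(\<Sum>t\<in>{1..N}. (if ev A t then lam A else 0) * (if ev B t then lam B else 0))
        \<le> real N * (lam A * lam B / (\<Prod>p\<in>A \<union> B. real p)) + \<bar>lam A\<bar> * \<bar>lam B\<bar>"
      using abs_le_D1[OF diff] unfolding eq main by (simp only: diff_le_eq add.commute)
  qed
  also have "\<dots> = real N * (\<Sum>A\<in>?D. \<Sum>B\<in>?D. lam A * lam B / (\<Prod>p\<in>A \<union> B. real p)) +
      (\<Sum>A\<in>?D. \<bar>lam A\<bar>)\<^sup>2"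
    unfolding power2_eq_square sum_product by (simp only: sum.distrib sum_distrib_left)
  also have "(\<Sum>A\<in>?D. \<Sum>B\<in>?D. lam A * lam B / (\<Prod>p\<in>A \<union> B. real p)) = 1 / selberg_sum ?D real"
    unfolding lam_def by (rule selberg_quadratic_form)
  also have "(\<Sum>A\<in>?D. \<bar>lam A\<bar>)\<^sup>2 \<le> (real R * real R)\<^sup>2"
  proof (intro power_mono sum_nonneg)
    have "(\<Sum>A\<in>?D. \<bar>lam A\<bar>) \<le> (\<Sum>A\<in>?D. real R)"
    proof (rule sum_mono)
      fix A assume A: "A \<in> ?D"
      have "\<bar>lam A\<bar> \<le> real (\<Prod>A)"
        using abs_selberg_weight_le[OF A] by (simp add: lam_def)
      also have "\<dots> \<le> real R" unfolding of_nat_le_iff using A by (simp add: prime_family_def)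
      finally show "\<bar>lam A\<bar> \<le> real R" .
    qed
    also have "\<dots> \<le> real R * real R" using card_prime_family_le[of q R] by (simp add: mult_right_mono)
    finally show "(\<Sum>A\<in>?D. \<bar>lam A\<bar>) \<le> real R * real R" .
  qed simp
  also have "(real R * real R)\<^sup>2 = real R ^ 4" by (simp add: power2_eq_square power4_eq_xxxx)
  finally have "real (card T2) \<le> real N / selberg_sum ?D real + real R ^ 4" by simp
  then show ?thesis using T1 unfolding T_split by simp
qed

text \<open>A version of \<open>u / ln u\<close> whose denominator is at least 1 for all
  \<open>u \<ge> 1\<close>, so that short ranges are covered too.\<close>

definition div_ln :: "real \<Rightarrow> real" where
  "div_ln u = u / (1 + ln u)"

lemma div_ln_mono:
  fixes a b :: real
  assumes "1 \<le> a" "a \<le> b"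
  shows "div_ln a \<le> div_ln b"
proof -
  have "ln (b / a) \<le> b / a - 1" using assms by (intro ln_le_minus_one) simp
  then have "a * ln b \<le> a * ln a + (b - a)"
    using assms by (simp add: ln_div field_simps)
  also have "a * ln a \<le> b * ln a" using assms by (intro mult_right_mono) auto
  finally have "a * (1 + ln b) \<le> b * (1 + ln a)" by (simp add: algebra_simps)
  moreover have "1 + ln a > 0" "1 + ln b > 0"
    using assms ln_ge_zero[of a] ln_ge_zero[of b] by linarith+
  ultimately show ?thesis unfolding div_ln_def by (simp add: divide_simps)
qed

text \<open>With \<open>R\<close> about \<open>N powr (1/8)\<close> the error \<open>R ^ 4\<close>
  is about the square root of \<open>N\<close>, while \<open>ln (R + 1)\<close> is still of the
  order of \<open>1 + ln N\<close>. The constant 36 is 32 from the main term plus 4 from the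
  error.\<close>

lemma brun_titchmarsh_weak:
  fixes q c :: nat and y :: real
  assumes q: "q > 0" and y: "y \<ge> 1"
    and T: "\<And>t. t \<in> T \<Longrightarrow> t \<ge> 1 \<and> real t \<le> y \<and> (\<exists>p. prime p \<and> p + c = q * t)"
  shows "real (card T) \<le> 36 * sigma_inv q * div_ln y"
proof -
  define N where "N = nat \<lfloor>y\<rfloor>"
  have N: "1 \<le> real N" "real N \<le> y" using y by (auto simp: N_def le_nat_iff le_floor_iff)
  define w where "w = real N powr (1/8)"
  have w8: "w ^ 8 = real N"
    using N by (simp add: w_def powr_realpow[symmetric] powr_powr)
  have w1: "w \<ge> 1" using N by (simp add: w_def ge_one_powr_ge_zero)
  have lnw: "ln w = ln N / 8" using N by (simp add: w_def ln_powr)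
  define R where "R = nat \<lfloor>w\<rfloor>"
  have R: "1 \<le> R" "real R \<le> w" "w < real R + 1"
    using w1 by (auto simp: R_def le_nat_iff le_floor_iff)
  define S where "S = selberg_sum (prime_family q R) real"
  interpret sieve_family "prime_family q R" real
    by (rule sieve_family_prime_family) fact
  have S: "S > 0" unfolding S_def by (rule selberg_sum_pos)
  have lnN: "ln (real N) \<ge> 0" using N by simp
  have sig: "sigma_inv q \<ge> 1" by (rule sigma_inv_ge_1) fact
  have "T \<subseteq> {1..N}"
  proof
    fix t assume "t \<in> T"
    then show "t \<in> {1..N}" using T[of t] by (simp add: N_def le_nat_floor)
  qed
  then have "real (card T) \<le> real N / S + real R ^ 4 + real R"
    unfolding S_def using T by (intro card_prime_values_le[OF q R(1), of _ _ c]) auto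
  moreover have "real N / S \<le> 32 * sigma_inv q * div_ln (real N)"
  proof -
    \<comment> \<open>The two lower bounds \<open>1 / 2\<close> and \<open>ln N / 8\<close> for
      \<open>ln (R + 1)\<close> are averaged, which also covers \<open>R = 1\<close>.\<close>
    have "ln 2 \<le> ln (real R + 1)" using R(1) by (subst ln_le_cancel_iff) auto
    moreover have "ln (1 / 2 :: real) = - ln 2" by (simp add: ln_div)
    ultimately have "1 / 2 \<le> ln (real R + 1)" using ln_le_minus_one[of "1 / 2"] by linarith
    moreover have "ln w \<le> ln (real R + 1)" using R w1 by simp
    ultimately have "(1 + ln (real N)) / 16 \<le> ln (real R + 1)" using lnw lnN by simp
    also have "\<dots> \<le> 2 * sigma_inv q * S"
      unfolding S_def by (rule ln_le_sigma_inv_selberg_sum[OF q R(1)])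
    finally have "1 + ln (real N) \<le> 32 * sigma_inv q * S" by simp
    then have "real N * (1 + ln (real N)) \<le> real N * (32 * sigma_inv q * S)"
      by (rule mult_left_mono) simp
    then show ?thesis using S lnN by (simp add: div_ln_def divide_simps mult_ac)
  qed
  moreover have "real R ^ 4 + real R \<le> 4 * sigma_inv q * div_ln (real N)"
  proof -
    have "real R \<le> real R ^ 4" using R(1) by (intro self_le_power) auto
    moreover have "real R ^ 4 \<le> w ^ 4" using R(2) by (intro power_mono) auto
    ultimately have le: "real R ^ 4 + real R \<le> 2 * w ^ 4" by linarith
    \<comment> \<open>Since \<open>w ^ 4\<close> is the square root of \<open>N\<close>, this bounds
      \<open>1 + ln N\<close> by twice that root.\<close>
    have "ln (w ^ 4) \<le> w ^ 4 - 1" using w1 by (intro ln_le_minus_one) simp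
    moreover have "ln (w ^ 4) = ln (real N) / 2" using w1 lnw by (simp add: ln_realpow)
    ultimately have "1 + ln (real N) \<le> 2 * w ^ 4" using one_le_power[OF w1, of 4] by linarith
    then have "2 * w ^ 4 * (1 + ln (real N)) \<le> 2 * w ^ 4 * (2 * w ^ 4)"
      using w1 by (intro mult_left_mono) auto
    also have "\<dots> = 4 * real N" by (simp flip: w8)
    finally have "2 * w ^ 4 \<le> 4 * div_ln (real N)"
      using lnN by (simp add: div_ln_def divide_simps)
    also have "\<dots> \<le> 4 * (sigma_inv q * div_ln (real N))"
      using sig lnN mult_right_mono[of 1 "sigma_inv q" "div_ln (real N)"] by (simp add: div_ln_def)
    finally show ?thesis using le by simp
  qed
  ultimately have "real (card T) \<le> 36 * sigma_inv q * div_ln (real N)" by simp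
  also have "\<dots> \<le> 36 * sigma_inv q * div_ln y"
    using sig div_ln_mono[OF N] by (intro mult_left_mono) auto
  finally show ?thesis .
qed

section \<open>Solutions with two denominators divisible by p\<close>

text \<open>The quadruple \<open>(k, b, m, t)\<close> stands for the solution
  \<open>(k b (m t - b), p k m b, p k m (m t - b))\<close>.\<close>
definition param_set :: "nat \<Rightarrow> (nat \<times> nat \<times> nat \<times> nat) set" where
  "param_set p = {(k, b, m, t). k > 0 \<and> b > 0 \<and> m > 0 \<and> t > 0 \<and> k * b * m * t \<le> p \<and>
     p + 4 * k * b ^ 2 = (4 * k * b * m - 1) * t}"

lemma finite_param_set: "finite (param_set p)"
proof (rule finite_subset)
  show "param_set p \<subseteq> {..p} \<times> {..p} \<times> {..p} \<times> {..p}"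
  proof (clarsimp simp: param_set_def)
    fix k b m t :: nat
    assume *: "0 < k" "0 < b" "0 < m" "0 < t" "k * b * m * t \<le> p"
    have "x \<le> p" if "x dvd k * b * m * t" for x
      using dvd_imp_le[OF that] * by simp
    then show "k \<le> p \<and> b \<le> p \<and> m \<le> p \<and> t \<le> p" by simp
  qed
qed simp

section \<open>From the Diophantine equation to the four parameters\<close>

lemma coprime_add_self:
  fixes u v :: nat
  assumes "coprime u v"
  shows "coprime u (u + v)"
proof (rule coprimeI)
  fix d assume "d dvd u" "d dvd u + v"
  then have "d dvd v" by (simp add: dvd_add_right_iff)
  with \<open>d dvd u\<close> assms show "is_unit d" using coprime_common_divisor by blast
qed

text \<open>Write \<open>n2 = p g b\<close> and \<open>n3 = p g c\<close> with \<open>b\<close>,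
  \<open>c\<close> coprime and clear denominators. Divisibility then yields in turn
  \<open>b c dvd a\<close>, so \<open>a = b c k\<close>; \<open>k dvd g\<close>, so
  \<open>g = k m\<close>; and \<open>m dvd b + c\<close>, so \<open>b + c = m t\<close>.\<close>

lemma solution_parametrization:
  fixes p a n2 n3 :: nat
  assumes p: "prime p" and pos: "a > 0" "n2 > 0" "n3 > 0"
    and eq: "4 / real p = 1 / real a + 1 / real n2 + 1 / real n3"
    and div: "\<not> p dvd a" "p dvd n2" "p dvd n3" and le: "n2 \<le> n3"
  obtains k b m t where "(k, b, m, t) \<in> param_set p"
    "a = k * b * (m * t - b)" "n2 = p * k * m * b" "n3 = p * k * m * (m * t - b)"
proof -
  obtain B C where BC: "n2 = p * B" "n3 = p * C" using div by (auto elim!: dvdE)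
  have p0: "p > 0" using p prime_gt_0_nat by simp
  have BC0: "B > 0" "C > 0" using pos BC by (auto intro!: Nat.gr0I)
  have "real (4 * a * B * C) = real (p * B * C + a * C + a * B)"
    using eq pos BC0 p0 unfolding BC by (simp add: field_simps)
  then have nat_eq: "4 * a * B * C = p * B * C + a * C + a * B" by (simp only: of_nat_eq_iff)
  define g where "g = gcd B C"
  obtain b c where bc: "B = g * b" "C = g * c" "coprime b c"
    using gcd_coprime_exists[of B C] BC0 unfolding g_def by (auto simp: mult.commute)
  have g0: "g > 0" and b0: "b > 0" and c0: "c > 0" using BC0 bc by (auto intro!: Nat.gr0I)
  have "g * (4 * a * (g * b * c)) = g * (p * (g * b * c) + a * (b + c))"
    using nat_eq unfolding bc by (simp add: algebra_simps)
  then have eq1: "4 * a * (g * b * c) = p * (g * b * c) + a * (b + c)" using g0 by simp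
  have "g * b * c dvd p * (g * b * c) + a * (b + c)" unfolding eq1[symmetric] by simp
  then have "g * b * c dvd a * (b + c)"
    using dvd_add_right_iff[of "g * b * c" "p * (g * b * c)"] by simp
  then have "b * c dvd a * (b + c)"
    using dvd_mult_right[of g "b * c"] by (simp only: mult.assoc)
  moreover have "coprime (b * c) (b + c)"
    using coprime_add_self[OF bc(3)] coprime_add_self[of c b] bc(3)
    by (simp add: coprime_commute add.commute)
  ultimately have "b * c dvd a" by (simp add: coprime_dvd_mult_left_iff)
  then obtain k where k: "a = b * c * k" by auto
  have k0: "k > 0" using k pos by (auto intro!: Nat.gr0I)
  have "(b * c) * (4 * k * g * b * c) = (b * c) * (p * g + k * (b + c))"
    using eq1 unfolding k by (simp add: algebra_simps)
  then have eq2: "4 * k * g * b * c = p * g + k * (b + c)" using b0 c0 by simp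
  have "k dvd p * g + k * (b + c)" unfolding eq2[symmetric] by simp
  then have "k dvd p * g" using dvd_add_left_iff[of k "k * (b + c)"] by simp
  \<comment> \<open>Here the assumption that \<open>p\<close> does not divide \<open>a\<close>
    enters.\<close>
  moreover have "coprime k p"
  proof -
    have "\<not> p dvd k" using div(1) dvd_mult[of p k "b * c"] unfolding k by blast
    then show ?thesis using prime_imp_coprime[OF p, of k] by (simp add: coprime_commute)
  qed
  ultimately have "k dvd g" by (simp add: coprime_dvd_mult_right_iff)
  then obtain m where m: "g = k * m" by auto
  have m0: "m > 0" using g0 m by (auto intro!: Nat.gr0I)
  have "k * (4 * k * m * b * c) = k * (p * m + (b + c))"
    using eq2 unfolding m by (simp add: algebra_simps)
  then have eq3: "4 * k * m * b * c = p * m + (b + c)" using k0 by simp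
  have "m dvd p * m + (b + c)" unfolding eq3[symmetric] by simp
  then have "m dvd b + c" using dvd_add_right_iff[of m "p * m"] by simp
  then obtain t where t: "b + c = m * t" by auto
  have t0: "t > 0" using t b0 by (auto intro!: Nat.gr0I)
  have "m * (4 * k * b * c) = m * (p + t)" using eq3 unfolding t by (simp add: algebra_simps)
  then have eq4: "4 * k * b * c = p + t" using m0 by simp
  have c: "c = m * t - b" using t by simp
  have "b \<le> c" using le BC bc p0 g0 by simp
  have "m * t \<le> 2 * c" using t \<open>b \<le> c\<close> by simp
  then have "k * b * (m * t) \<le> k * b * (2 * c)" by (intro mult_left_mono) auto
  moreover have "k * b * m * t = k * b * (m * t)" "k * b * (2 * c) = 2 * (k * b * c)"
    "4 * k * b * c = 4 * (k * b * c)" by simp_all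
  \<comment> \<open>Thus \<open>t\<close> is at most half of \<open>4 k b c = p + t\<close>, which
    leaves \<open>p \<ge> 2 k b c \<ge> k b m t\<close>.\<close>
  moreover have "t \<le> 2 * (k * b * c)"
  proof -
    have "t \<le> m * t" using m0 by simp
    also have "\<dots> \<le> 2 * c" by fact
    also have "\<dots> \<le> 2 * (k * b * c)" using k0 b0 by simp
    finally show ?thesis .
  qed
  ultimately have bound: "k * b * m * t \<le> p" using eq4 by linarith
  have "p + t + 4 * k * b ^ 2 = 4 * k * b * (b + c)"
    using eq4 by (simp add: algebra_simps power2_eq_square)
  then have "p + 4 * k * b ^ 2 = 4 * k * b * m * t - t" unfolding t by (simp add: mult.assoc)
  then have "(k, b, m, t) \<in> param_set p"
    using k0 b0 m0 t0 bound by (simp add: param_set_def diff_mult_distrib)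
  moreover have "a = k * b * (m * t - b)" using k c by simp
  moreover have "n2 = p * k * m * b" "n3 = p * k * m * (m * t - b)"
    using BC bc m c by simp_all
  ultimately show thesis by (rule that)
qed

text \<open>The factor 6 accounts for the position of the denominator prime to \<open>p\<close> and
  the order of the other two.\<close>

lemma f2_le_card_param_set:
  assumes "prime p"
  shows "f2 p \<le> 6 * card (param_set p)"
proof -
  define G where "G = (\<lambda>(k,b,m,t). (k * b * (m * t - b), p * k * m * b, p * k * m * (m * t - b))) `
    param_set p"
  \<comment> \<open>The six coordinate permutations are given as a list, so that
    \<open>card P \<le> 6\<close> follows from its length without showing them distinct.\<close>
  define P where "P = set [\<lambda>(x,y,z). (x,y,z), \<lambda>(x,y,z). (x,z,y), \<lambda>(x,y,z). (y,x,z),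
    \<lambda>(x,y,z). (z,x,y), \<lambda>(x,y,z). (y,z,x), \<lambda>(x,y,z::nat). (z::nat,y::nat,x::nat)]"
  have finG: "finite G" and cardG: "card G \<le> card (param_set p)"
    unfolding G_def by (auto intro: card_image_le finite_param_set)
  have G_sorted: "(a, n2, n3) \<in> G"
    if "a > 0" "n2 > 0" "n3 > 0" "4 / real p = 1 / real a + 1 / real n2 + 1 / real n3"
      "\<not> p dvd a" "p dvd n2" "p dvd n3" "n2 \<le> n3" for a n2 n3
  proof (rule solution_parametrization[OF assms that])
    fix k b m t
    assume "(k, b, m, t) \<in> param_set p" "a = k * b * (m * t - b)" "n2 = p * k * m * b"
      "n3 = p * k * m * (m * t - b)"
    then show "(a, n2, n3) \<in> G" unfolding G_def by (intro image_eqI[of _ _ "(k, b, m, t)"]) simp_all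
  qed
  have G: "(a, n2, n3) \<in> G \<or> (a, n3, n2) \<in> G"
    if "a > 0" "n2 > 0" "n3 > 0" "4 / real p = 1 / real a + 1 / real n2 + 1 / real n3"
      "\<not> p dvd a" "p dvd n2" "p dvd n3" for a n2 n3
    using G_sorted[of a n2 n3] G_sorted[of a n3 n2] that by (cases "n2 \<le> n3") auto
  define U where "U = (\<Union>\<pi>\<in>P. \<pi> ` G)"
  have U: "\<pi> u \<in> U" if "\<pi> \<in> P" "u \<in> G" for \<pi> u using that unfolding U_def by blast
  have perm: "(x, y, z) \<in> U \<and> (x, z, y) \<in> U \<and> (y, x, z) \<in> U \<and> (z, x, y) \<in> U \<and>
      (y, z, x) \<in> U \<and> (z, y, x) \<in> U" if "(x, y, z) \<in> G" for x y z
    using U[OF _ that, of "\<lambda>(x,y,z). (x,y,z)"] U[OF _ that, of "\<lambda>(x,y,z). (x,z,y)"]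
      U[OF _ that, of "\<lambda>(x,y,z). (y,x,z)"] U[OF _ that, of "\<lambda>(x,y,z). (z,x,y)"]
      U[OF _ that, of "\<lambda>(x,y,z). (y,z,x)"] U[OF _ that, of "\<lambda>(x,y,z). (z,y,x)"]
    unfolding P_def by simp
  have "{s \<in> sol_set p. ndiv p s = 2} \<subseteq> U"
  proof
    fix s assume "s \<in> {s \<in> sol_set p. ndiv p s = 2}"
    then obtain x y z where s: "s = (x, y, z)" "x > 0" "y > 0" "z > 0"
      and eq: "4 / real p = 1 / real x + 1 / real y + 1 / real z"
      and nd: "ndiv p (x, y, z) = 2"
      by (auto simp: sol_set_def)
    consider "\<not> p dvd x" "p dvd y" "p dvd z" | "p dvd x" "\<not> p dvd y" "p dvd z"
      | "p dvd x" "p dvd y" "\<not> p dvd z"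
      using nd by (auto simp: ndiv_def split: if_splits)
    then show "s \<in> U"
    proof cases
      case 1
      then have "(x, y, z) \<in> G \<or> (x, z, y) \<in> G" using s eq by (intro G) auto
      then show ?thesis using perm unfolding s by blast
    next
      case 2
      then have "(y, x, z) \<in> G \<or> (y, z, x) \<in> G" using s eq by (intro G) auto
      then show ?thesis using perm unfolding s by blast
    next
      case 3
      then have "(z, x, y) \<in> G \<or> (z, y, x) \<in> G" using s eq by (intro G) auto
      then show ?thesis using perm unfolding s by blast
    qed
  qed
  then have "f2 p \<le> card U"
    unfolding f2_def f_i_def by (intro card_mono) (auto simp: U_def P_def finG)
  also have "\<dots> \<le> (\<Sum>\<pi>\<in>P. card (\<pi> ` G))" unfolding U_def by (rule card_UN_le) (simp add: P_def)
  also have "\<dots> \<le> (\<Sum>\<pi>\<in>P. card G)" by (intro sum_mono card_image_le finG)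
  also have "\<dots> \<le> 6 * card G"
  proof -
    have "card P \<le> 6" unfolding P_def by (rule order.trans[OF card_length]) simp
    then show ?thesis by simp
  qed
  also have "\<dots> \<le> 6 * card (param_set p)" using cardG by simp
  finally show ?thesis .
qed

section \<open>Sums along residue classes\<close>

lemma sum_inverse_le:
  assumes "N \<ge> 1"
  shows "(\<Sum>n=1..N. 1 / real n) \<le> 1 + ln (real N)"
  using assms
proof (induction N rule: nat_induct_at_least)
  case (Suc n)
  have "ln (real n / real (Suc n)) \<le> real n / real (Suc n) - 1"
    using Suc.hyps by (intro ln_le_minus_one) simp
  also have "\<dots> = - (1 / real (Suc n))" by (simp add: field_simps)
  finally have "1 / real (Suc n) \<le> ln (real (Suc n)) - ln (real n)"
    using Suc.hyps by (simp add: ln_div)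
  then show ?case using Suc.IH by simp
qed simp

text \<open>Every element of \<open>X\<close> except the least ends a block of \<open>d\<close>
  consecutive integers on which \<open>h\<close> is at least its value at the end. These blocks are
  disjoint, and the least element is compared with \<open>L\<close>.\<close>

lemma sum_residue_class_le:
  fixes h :: "nat \<Rightarrow> real"
  assumes d: "d > 0" and L: "1 \<le> L" "L \<le> M" and X: "X \<subseteq> {L..M}"
    and cong: "\<And>m n. m \<in> X \<Longrightarrow> n \<in> X \<Longrightarrow> [m = n] (mod d)"
    and antimono: "\<And>m n. 1 \<le> m \<Longrightarrow> m \<le> n \<Longrightarrow> n \<le> M \<Longrightarrow> h n \<le> h m"
    and nonneg: "\<And>m. 1 \<le> m \<Longrightarrow> m \<le> M \<Longrightarrow> h m \<ge> 0"
  shows "sum h X \<le> h L + (\<Sum>m=1..M. h m) / real d"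
proof (cases "X = {}")
  case True
  then show ?thesis using nonneg L by (auto intro!: add_nonneg_nonneg divide_nonneg_nonneg sum_nonneg)
next
  case False
  have fin: "finite X" using X finite_subset by blast
  define m0 where "m0 = Min X"
  have m0: "m0 \<in> X" "\<And>m. m \<in> X \<Longrightarrow> m0 \<le> m" using fin False by (auto simp: m0_def)
  have X1: "L \<le> m" "m \<le> M" if "m \<in> X" for m using X that by auto
  have gap: "m + d \<le> n" if "m \<in> X" "n \<in> X" "m < n" for m n
  proof -
    have "d dvd n - m" using cong[OF that(2,1)] that(3) by (simp add: cong_altdef_nat)
    then have "d \<le> n - m" using that(3) by (intro dvd_imp_le) auto
    then show ?thesis using that(3) by linarith
  qed
  define I where "I m = {m - d<..m}" for m
  \<comment> \<open>This makes the truncated subtraction in \<open>I m\<close> exact, so that the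
    block has \<open>d\<close> elements, all positive.\<close>
  have big: "m > m0 \<and> m \<ge> m0 + d" if "m \<in> X - {m0}" for m
    using gap[OF m0(1), of m] m0(2)[of m] that by (cases "m = m0") auto
  have "h m \<le> sum h (I m) / real d" if m: "m \<in> X - {m0}" for m
  proof -
    have "(\<Sum>j\<in>I m. h m) \<le> sum h (I m)"
    proof (rule sum_mono)
      fix j assume "j \<in> I m"
      then show "h m \<le> h j" using X1[of m] m by (intro antimono) (auto simp: I_def)
    qed
    moreover have "card (I m) = d" using big[OF m] by (simp add: I_def)
    ultimately show ?thesis using d by (simp add: le_divide_eq mult.commute)
  qed
  then have "sum h (X - {m0}) \<le> (\<Sum>m\<in>X - {m0}. sum h (I m) / real d)"
    by (rule sum_mono)
  also have "\<dots> = (\<Sum>m\<in>X - {m0}. sum h (I m)) / real d" by (simp only: sum_divide_distrib)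
  also have "(\<Sum>m\<in>X - {m0}. sum h (I m)) = sum h (\<Union>m\<in>X - {m0}. I m)"
  proof (rule sum.UNION_disjoint[symmetric])
    show "\<forall>m\<in>X - {m0}. \<forall>n\<in>X - {m0}. m \<noteq> n \<longrightarrow> I m \<inter> I n = {}"
    proof (intro ballI impI)
      fix m n assume mn: "m \<in> X - {m0}" "n \<in> X - {m0}" "m \<noteq> n"
      then consider "m + d \<le> n" | "n + d \<le> m" using gap[of m n] gap[of n m] by fastforce
      then show "I m \<inter> I n = {}" by cases (auto simp: I_def)
    qed
  qed (use fin in \<open>auto simp: I_def\<close>)
  also have "\<dots> \<le> (\<Sum>m=1..M. h m)"
    using X1 nonneg by (intro sum_mono2) (fastforce simp: I_def)+
  finally have "sum h (X - {m0}) \<le> (\<Sum>m=1..M. h m) / real d"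
    using d by (simp add: divide_right_mono)
  moreover have "h m0 \<le> h L" using X1[OF m0(1)] L by (intro antimono) auto
  moreover have "sum h X = h m0 + sum h (X - {m0})" using fin m0(1) by (rule sum.remove)
  ultimately show ?thesis by simp
qed

section \<open>Sums of \<open>div_ln\<close> with and without divisor weights\<close>

lemma div_ln_nonneg: "u \<ge> 1 \<Longrightarrow> div_ln u \<ge> 0"
  unfolding div_ln_def by (intro divide_nonneg_nonneg add_nonneg_nonneg) auto

lemma div_ln_le: "u \<ge> 1 \<Longrightarrow> div_ln u \<le> u"
  using divide_left_mono[of 1 "1 + ln u" u] ln_ge_zero[of u] unfolding div_ln_def
  by (simp add: add_pos_nonneg)

text \<open>The summand \<open>y / (m * (1 + ln (y / m)))\<close> resembles the derivative in
  \<open>m\<close> of \<open>- y * ln (1 + ln (y / m))\<close>. The induction retains the value of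
  this primitive at \<open>M\<close>, which is dropped only at the end.\<close>

lemma sum_div_ln_le:
  fixes y :: real
  assumes "M \<ge> 1" "real M \<le> y"
  shows "(\<Sum>m=1..M. div_ln (y / real m)) \<le> y * (1 + 2 * ln (1 + ln y))"
proof -
  have "(\<Sum>m=1..M. div_ln (y / real m)) \<le>
      y * (1 + 2 * (ln (1 + ln y) - ln (1 + ln (y / real M))))"
    using assms
  proof (induction M rule: nat_induct_at_least)
    case base
    then show ?case using div_ln_le[of y] by simp
  next
    case (Suc n)
    define A where "A = 1 + ln (y / real (Suc n))"
    define \<delta> where "\<delta> = ln (real (Suc n) / real n)"
    have n: "n \<ge> 1" and y: "y > 0" "real (Suc n) \<le> y" using Suc by auto
    have A1: "A \<ge> 1" using y by (simp add: A_def)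
    have B: "1 + ln (y / real n) = A + \<delta>"
      using n y by (simp add: A_def \<delta>_def ln_div)
    have "ln (real n / real (Suc n)) \<le> real n / real (Suc n) - 1"
      using n by (intro ln_le_minus_one) simp
    also have "\<dots> = - (1 / real (Suc n))" by (simp add: field_simps)
    finally have \<delta>_ge: "1 / real (Suc n) \<le> \<delta>" using n by (simp add: \<delta>_def ln_div)
    have "\<delta> \<le> real (Suc n) / real n - 1" unfolding \<delta>_def using n by (intro ln_le_minus_one) simp
    also have "\<dots> \<le> 1" using n by (simp add: field_simps)
    \<comment> \<open>This gives \<open>A + \<delta> \<le> 2 * A\<close>, the source of the factor 2
      in the bound.\<close>
    finally have \<delta>_le: "\<delta> \<le> A" using A1 by simp
    have \<delta>_pos: "\<delta> > 0" using \<delta>_ge by (rule less_le_trans[rotated]) simp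
    have "1 / real (Suc n) / (2 * A) \<le> \<delta> / (2 * A)"
      using \<delta>_ge A1 by (intro divide_right_mono) auto
    also have "\<dots> \<le> \<delta> / (A + \<delta>)"
      using \<delta>_le \<delta>_pos A1 by (intro divide_left_mono) auto
    also have "\<dots> = - (A / (A + \<delta>) - 1)" using \<delta>_pos A1 by (simp add: field_simps)
    also have "\<dots> \<le> - ln (A / (A + \<delta>))"
      using \<delta>_pos A1 ln_le_minus_one[of "A / (A + \<delta>)"] by simp
    also have "\<dots> = ln (A + \<delta>) - ln A" using \<delta>_pos A1 by (simp add: ln_div)
    finally have "y * (2 * (1 / real (Suc n) / (2 * A))) \<le> y * (2 * (ln (A + \<delta>) - ln A))"
      using y by (intro mult_left_mono) auto
    moreover have "div_ln (y / real (Suc n)) = y * (2 * (1 / real (Suc n) / (2 * A)))"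
      unfolding div_ln_def A_def[symmetric] by simp
    ultimately have "div_ln (y / real (Suc n)) \<le> y * (2 * (ln (A + \<delta>) - ln A))" by simp
    moreover have "(\<Sum>m=1..n. div_ln (y / real m)) \<le>
        y * (1 + 2 * (ln (1 + ln y) - ln (A + \<delta>)))"
      using Suc.IH y unfolding B by simp
    ultimately show ?case unfolding A_def[symmetric] by (simp add: algebra_simps A_def)
  qed
  also have "\<dots> \<le> y * (1 + 2 * ln (1 + ln y))"
    using assms by (intro mult_left_mono) auto
  finally show ?thesis .
qed

text \<open>After interchanging the sums, each \<open>d\<close> restricts \<open>m\<close> to at
  most one residue class. The least elements contribute \<open>h L / d\<close>, a harmonic sum over
  \<open>d\<close>; the rest contributes \<open>H / d ^ 2\<close>, a convergent one.\<close>

lemma sum_sigma_inv_div_ln_le: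
  fixes y :: real
  assumes u: "u \<ge> 1" and L: "L \<ge> 1" "real L \<le> y"
    and W: "W \<ge> 1" "\<And>m. real m \<le> y \<Longrightarrow> 4 * u * m \<le> W"
  shows "(\<Sum>m\<in>{m. L \<le> m \<and> real m \<le> y}. sigma_inv (4 * u * m - 1) * div_ln (y / real m)) \<le>
    y * ((1 + ln (real W)) / real L + 2 * (1 + 2 * ln (1 + ln y)))"
proof -
  define M where "M = nat \<lfloor>y\<rfloor>"
  have y1: "y \<ge> 1" using L by simp
  have M_iff: "real m \<le> y \<longleftrightarrow> m \<le> M" for m
    using y1 by (auto simp: M_def le_nat_iff le_floor_iff)
  have M: "1 \<le> M" "L \<le> M" "real M \<le> y" using L y1 M_iff[of L] M_iff[of 1] M_iff[of M] by auto
  define h where "h m = div_ln (y / real m)" for m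
  have h_antimono: "h n \<le> h m" if "1 \<le> m" "m \<le> n" "n \<le> M" for m n
    unfolding h_def using that M_iff[of n]
    by (intro div_ln_mono divide_left_mono) (auto simp: le_divide_eq)
  have h_nonneg: "h m \<ge> 0" if "1 \<le> m" "m \<le> M" for m
    unfolding h_def using that M_iff[of m] by (intro div_ln_nonneg) (auto simp: le_divide_eq)
  have hL: "h L \<le> y / real L"
    unfolding h_def using L by (intro div_ln_le) (auto simp: le_divide_eq)
  define H where "H = (\<Sum>m=1..M. h m)"
  have H: "0 \<le> H" "H \<le> y * (1 + 2 * ln (1 + ln y))"
    unfolding H_def using h_nonneg sum_div_ln_le[OF M(1,3)] by (auto simp: h_def intro: sum_nonneg)
  have "{m. L \<le> m \<and> real m \<le> y} = {L..M}" by (auto simp: M_iff)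
  then have "(\<Sum>m\<in>{m. L \<le> m \<and> real m \<le> y}. sigma_inv (4 * u * m - 1) * div_ln (y / real m)) =
      (\<Sum>m\<in>{L..M}. \<Sum>d\<in>{1..W}. if d dvd 4 * u * m - 1 then 1 / real d * h m else 0)"
  proof (simp only:, intro sum.cong refl)
    fix m assume m: "m \<in> {L..M}"
    have pos: "4 * u * m \<ge> 4" using m u L by simp
    \<comment> \<open>The cutoff \<open>W\<close> makes the range of \<open>d\<close> independent of
      \<open>m\<close>.\<close>
    have "{d. d dvd 4 * u * m - 1} = {d\<in>{1..W}. d dvd 4 * u * m - 1}"
    proof -
      have "1 \<le> d \<and> d \<le> W" if d: "d dvd 4 * u * m - 1" for d
      proof -
        have "0 < 4 * u * m - 1" using pos by linarith
        then have "d > 0" "d \<le> 4 * u * m - 1" using dvd_pos_nat[OF _ d] dvd_imp_le[OF d] by auto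
        then show ?thesis using W(2)[of m] m M_iff[of m] by auto
      qed
      then show ?thesis by auto
    qed
    then have "sigma_inv (4 * u * m - 1) =
        (\<Sum>d\<in>{1..W}. if d dvd 4 * u * m - 1 then 1 / real d else 0)"
      unfolding sigma_inv_def by (simp only: sum.inter_filter finite_atLeastAtMost)
    then show "sigma_inv (4 * u * m - 1) * div_ln (y / real m) =
        (\<Sum>d\<in>{1..W}. if d dvd 4 * u * m - 1 then 1 / real d * h m else 0)"
      unfolding h_def[symmetric] by (simp only: sum_distrib_right) (intro sum.cong, auto)
  qed
  also have "\<dots> = (\<Sum>d\<in>{1..W}. \<Sum>m\<in>{L..M}. if d dvd 4 * u * m - 1 then 1 / real d * h m else 0)"
    by (rule sum.swap)
  also have "\<dots> \<le> (\<Sum>d\<in>{1..W}. h L * (1 / real d) + H * (1 / real d ^ 2))"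
  proof (rule sum_mono)
    fix d assume d: "d \<in> {1..W}"
    define X where "X = {m\<in>{L..M}. d dvd 4 * u * m - 1}"
    have cong1: "[(4 * u) * m = Suc 0] (mod d)" if "m \<in> X" for m
    proof -
      have "1 \<le> 4 * u * m" using that u L by (simp add: X_def)
      then show ?thesis using that cong_altdef_nat[of 1 "4 * u * m" d] by (simp add: X_def)
    qed
    have "sum h X \<le> h L + H / real d"
      unfolding H_def
    proof (rule sum_residue_class_le)
      fix m n assume mn: "m \<in> X" "n \<in> X"
      \<comment> \<open>Any element of \<open>X\<close> is an inverse of \<open>4 * u\<close> modulo
        \<open>d\<close>.\<close>
      have "coprime (4 * u) d" using cong1[OF mn(1)] coprime_iff_invertible_nat by blast
      moreover have "[(4 * u) * m = (4 * u) * n] (mod d)"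
        using cong1[OF mn(1)] cong1[OF mn(2)] cong_sym cong_trans by blast
      ultimately show "[m = n] (mod d)" using cong_mult_lcancel_nat by blast
    qed (use d L M h_antimono h_nonneg in \<open>auto simp: X_def\<close>)
    then have "1 / real d * sum h X \<le> 1 / real d * (h L + H / real d)"
      by (intro mult_left_mono) auto
    also have "\<dots> = h L * (1 / real d) + H * (1 / real d ^ 2)"
      by (simp add: algebra_simps power2_eq_square)
    finally have "1 / real d * sum h X \<le> h L * (1 / real d) + H * (1 / real d ^ 2)" .
    moreover have "(\<Sum>m\<in>{L..M}. if d dvd 4 * u * m - 1 then 1 / real d * h m else 0) =
        1 / real d * sum h X"
      unfolding X_def sum_distrib_left by (rule sum.inter_filter[symmetric]) simp
    ultimately show "(\<Sum>m\<in>{L..M}. if d dvd 4 * u * m - 1 then 1 / real d * h m else 0) \<le>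
        h L * (1 / real d) + H * (1 / real d ^ 2)" by simp
  qed
  also have "\<dots> = h L * (\<Sum>d=1..W. 1 / real d) + H * (\<Sum>d=1..W. 1 / real d ^ 2)"
    by (simp only: sum.distrib sum_distrib_left)
  also have "\<dots> \<le> (y / real L) * (1 + ln (real W)) + (y * (1 + 2 * ln (1 + ln y))) * 2"
  proof (rule add_mono)
    show "h L * (\<Sum>d=1..W. 1 / real d) \<le> (y / real L) * (1 + ln (real W))"
      using hL sum_inverse_le[OF W(1)] y1 by (intro mult_mono sum_nonneg) auto
    show "H * (\<Sum>d=1..W. 1 / real d ^ 2) \<le> (y * (1 + 2 * ln (1 + ln y))) * 2"
      using H sum_inverse_squares_le[of "{1..W}"] by (intro mult_mono sum_nonneg) auto
  qed
  also have "\<dots> = y * ((1 + ln (real W)) / real L + 2 * (1 + 2 * ln (1 + ln y)))"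
    by (simp add: algebra_simps add_divide_distrib)
  finally show ?thesis .
qed

section \<open>Summation over the parameters\<close>

text \<open>For fixed \<open>k\<close>, \<open>b\<close>, \<open>m\<close> the equation determines
  \<open>p\<close> from \<open>t\<close>, so counting \<open>t\<close> alone counts the
  pairs.\<close>

definition param_count :: "nat \<Rightarrow> nat \<Rightarrow> nat \<Rightarrow> real \<Rightarrow> nat set" where
  "param_count k b m y = {t. t \<ge> 1 \<and> real t \<le> y \<and>
     (\<exists>p. prime p \<and> p + 4 * k * b ^ 2 = (4 * k * b * m - 1) * t)}"

lemma finite_param_count: "finite (param_count k b m y)"
proof (rule finite_subset)
  show "param_count k b m y \<subseteq> {..nat \<lfloor>y\<rfloor>}" by (auto simp: param_count_def le_nat_floor)
qed simp

text \<open>Forgetting \<open>p\<close> is injective because the equation recovers it, and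
  \<open>k b m t \<le> p < x\<close> supplies the range of \<open>t\<close>.\<close>

lemma sum_card_param_set_le:
  fixes x :: real
  defines "X \<equiv> nat \<lfloor>x\<rfloor>"
  defines "Tri \<equiv> {(k, b, m). k \<in> {1..X} \<and> b \<in> {1..X} \<and> m \<in> {1..X} \<and> real (k * b * m) \<le> x}"
  shows "(\<Sum>p | prime p \<and> real p < x. card (param_set p)) \<le>
    (\<Sum>(k, b, m)\<in>Tri. card (param_count k b m (x / real (k * b * m))))"
proof -
  let ?P = "{p. prime p \<and> real p < x}"
  let ?T = "\<lambda>(k, b, m). param_count k b m (x / real (k * b * m))"
  let ?F = "\<lambda>(p::nat, k, b, m, t::nat). ((k::nat, b::nat, m::nat), t)"
  have finP: "finite ?P"
    by (rule finite_subset[of _ "{..X}"]) (auto simp: X_def intro: le_nat_floor less_imp_le)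
  have "Tri \<subseteq> {1..X} \<times> {1..X} \<times> {1..X}" by (auto simp: Tri_def)
  then have finTri: "finite Tri" by (rule finite_subset) simp
  have "inj_on ?F (Sigma ?P param_set)"
    by (auto simp: inj_on_def param_set_def)
  moreover have "?F ` Sigma ?P param_set \<subseteq> Sigma Tri ?T"
  proof (clarsimp simp: param_set_def)
    fix p k b m t :: nat
    assume p: "prime p" "real p < x" and pos: "0 < k" "0 < b" "0 < m" "0 < t"
      and le: "k * b * m * t \<le> p" and eq: "p + 4 * k * b\<^sup>2 = (4 * k * b * m - Suc 0) * t"
    have "real (k * b * m * t) \<le> x" using le p(2) by (meson less_imp_le of_nat_le_iff order.trans)
    then have bound: "real n \<le> x" if "n dvd k * b * m * t" for n
      using dvd_imp_le[OF that] pos by (meson mult_pos_pos of_nat_le_iff order.trans)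
    have "real k \<le> x" "real b \<le> x" "real m \<le> x" "real (k * b * m) \<le> x"
      using bound by (simp_all del: of_nat_mult)
    then have "(k, b, m) \<in> Tri" using pos by (simp add: Tri_def X_def le_nat_floor)
    moreover have "t \<in> param_count k b m (x / real (k * b * m))"
      using \<open>real (k * b * m * t) \<le> x\<close> pos p(1) eq
      by (auto simp: param_count_def le_divide_eq mult_ac)
    ultimately show "(k, b, m) \<in> Tri \<and> t \<in> param_count k b m (x / (real k * real b * real m))"
      by simp
  qed
  moreover have "finite (Sigma Tri ?T)"
    using finTri finite_param_count by (intro finite_SigmaI) auto
  ultimately have "card (Sigma ?P param_set) \<le> card (Sigma Tri ?T)" by (rule card_inj_on_le)
  moreover have "card (Sigma ?P param_set) = (\<Sum>p\<in>?P. card (param_set p))"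
    using finP finite_param_set by (intro card_SigmaI) auto
  moreover have "card (Sigma Tri ?T) = (\<Sum>(k, b, m)\<in>Tri. card (param_count k b m (x / real (k * b * m))))"
    using finTri finite_param_count by (subst card_SigmaI) (auto intro: sum.cong)
  ultimately show ?thesis by simp
qed

lemma card_param_count_le:
  assumes "k \<ge> 1" "b \<ge> 1" "m \<ge> 1" "y \<ge> 1"
  shows "real (card (param_count k b m y)) \<le> 36 * (sigma_inv (4 * (k * b) * m - 1) * div_ln y)"
proof -
  have "4 * (k * b) * m > 1" using assms by (simp add: Suc_lessI)
  then have "real (card (param_count k b m y)) \<le>
      36 * sigma_inv (4 * (k * b) * m - 1) * div_ln y"
    using assms(4)
    by (intro brun_titchmarsh_weak[where c = "4 * k * b ^ 2"]) (auto simp: param_count_def mult.assoc)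
  then show ?thesis by simp
qed

text \<open>In the half \<open>b \<le> m\<close> the previous bound is applied with
  \<open>L = b\<close> and \<open>y = x / (k b)\<close>. The term carrying the extra
  \<open>ln (4 x)\<close> then has weight \<open>1 / (k b ^ 2)\<close>, whose sum over
  \<open>b\<close> converges, while the main term has weight \<open>1 / (k b)\<close> and costs two
  logarithms.\<close>

lemma sum_triples_le:
  fixes x :: real
  assumes x: "x \<ge> 1"
  defines "X \<equiv> nat \<lfloor>x\<rfloor>"
  defines "Tri \<equiv> {(k, b, m). k \<in> {1..X} \<and> b \<in> {1..X} \<and> m \<in> {1..X} \<and> real (k * b * m) \<le> x}"
  shows "(\<Sum>(k, b, m)\<in>Tri. sigma_inv (4 * (k * b) * m - 1) * div_ln (x / real (k * b * m))) \<le>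
    2 * x * (2 * (1 + ln (4 * x)) * (1 + ln x) + 2 * (1 + 2 * ln (1 + ln x)) * (1 + ln x)\<^sup>2)"
proof -
  define F where "F = (\<lambda>(k, b, m). sigma_inv (4 * (k * b) * m - 1) * div_ln (x / real (k * b * m)))"
  define W where "W = nat \<lfloor>4 * x\<rfloor>"
  define Y where "Y = 1 + 2 * ln (1 + ln x)"
  have X: "X \<ge> 1" "real X \<le> x" using x by (auto simp: X_def le_nat_iff le_floor_iff)
  have W: "W \<ge> 1" "real W \<le> 4 * x" using x by (auto simp: W_def le_nat_iff le_floor_iff)
  have lnx: "ln x \<ge> 0" using x by simp
  have "Tri \<subseteq> {1..X} \<times> {1..X} \<times> {1..X}" by (auto simp: Tri_def)
  then have finTri: "finite Tri" by (rule finite_subset) simp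
  have F_nonneg: "F v \<ge> 0" if "v \<in> Tri" for v
    using that unfolding F_def Tri_def
    by (auto intro!: mult_nonneg_nonneg div_ln_nonneg
        simp: sigma_inv_def sum_nonneg le_divide_eq)
  \<comment> \<open>The diagonal \<open>b = m\<close> lies in both halves; counting it twice is
    harmless because \<open>F\<close> is nonnegative.\<close>
  define Tri' where "Tri' = {v \<in> Tri. case v of (k, b, m) \<Rightarrow> b \<le> m}"
  define Tri'' where "Tri'' = {v \<in> Tri. case v of (k, b, m) \<Rightarrow> m \<le> b}"
  have fin': "finite Tri'" "finite Tri''" using finTri by (auto simp: Tri'_def Tri''_def)
  have "Tri \<subseteq> Tri' \<union> Tri''" by (auto simp: Tri'_def Tri''_def)
  then have "sum F Tri \<le> sum F (Tri' \<union> Tri'')"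
    using fin' F_nonneg by (intro sum_mono2) (auto simp: Tri'_def Tri''_def)
  also have "\<dots> \<le> sum F Tri' + sum F Tri''"
  proof -
    have "sum F (Tri' \<inter> Tri'') \<ge> 0" by (rule sum_nonneg) (use F_nonneg in \<open>auto simp: Tri'_def\<close>)
    then show ?thesis using sum.union_inter[OF fin', of F] by simp
  qed
  also have "sum F Tri'' = sum F Tri'"
    by (rule sum.reindex_bij_witness[of _ "\<lambda>(k, b, m). (k, m, b)" "\<lambda>(k, b, m). (k, m, b)"])
      (auto simp: Tri'_def Tri''_def Tri_def F_def mult_ac)
  also have "sum F Tri' \<le> (\<Sum>(k, b)\<in>{1..X} \<times> {1..X}.
      x * ((1 + ln (4 * x)) * (1 / real k * (1 / real b ^ 2)) + 2 * Y * (1 / real k * (1 / real b))))"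
  proof -
    define U where "U = (\<lambda>(k, b). {m. b \<le> m \<and> real m \<le> x / real (k * b)})"
    have finU: "finite (U v)" for v
    proof (rule finite_subset)
      show "U v \<subseteq> {..nat \<lfloor>x / real (fst v * snd v)\<rfloor>}"
        by (auto simp: U_def split_beta intro: le_nat_floor)
    qed simp
    have bounds: "real (k * b * m) \<le> x \<and> m \<le> X"
      if "k \<ge> 1" "b \<ge> 1" "real m \<le> x / real (k * b)" for k b m
    proof -
      have kbm: "real (k * b * m) \<le> x" using that by (simp add: le_divide_eq mult_ac)
      have "m \<le> k * b * m" using that by simp
      then have "real m \<le> x" using kbm by (meson of_nat_le_iff order.trans)
      then show ?thesis using kbm unfolding X_def by (simp add: le_nat_floor)
    qed
    have "sum F Tri' = (\<Sum>((k, b), m)\<in>Sigma ({1..X} \<times> {1..X}) U. F (k, b, m))"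
    proof (rule sum.reindex_bij_witness[where i = "\<lambda>((k, b), m). (k, b, m)" and j = "\<lambda>(k, b, m). ((k, b), m)"])
      let ?i = "\<lambda>((k, b), m). (k, b, m) :: nat \<times> nat \<times> nat"
      fix v assume "v \<in> Sigma ({1..X} \<times> {1..X}) U"
      then show "?i v \<in> Tri'"
        using bounds by (auto simp: Tri'_def Tri_def U_def)
    qed (auto simp: Tri'_def Tri_def U_def le_divide_eq mult_less_0_iff mult_ac)
    also have "\<dots> = (\<Sum>(k, b)\<in>{1..X} \<times> {1..X}. \<Sum>m\<in>U (k, b). F (k, b, m))"
      using finU by (subst sum.Sigma[symmetric]) (auto simp: split_beta)
    also have "\<dots> \<le> (\<Sum>(k, b)\<in>{1..X} \<times> {1..X}.
      x * ((1 + ln (4 * x)) * (1 / real k * (1 / real b ^ 2)) + 2 * Y * (1 / real k * (1 / real b))))"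
    proof (rule sum_mono, clarify)
      fix k b assume kb: "k \<in> {1..X}" "b \<in> {1..X}"
      define y where "y = x / real (k * b)"
      have Y0: "Y \<ge> 0" using lnx by (simp add: Y_def)
      have ln4x: "ln (4 * x) \<ge> 0" using x by simp
      show "(\<Sum>m\<in>U (k, b). F (k, b, m)) \<le>
        x * ((1 + ln (4 * x)) * (1 / real k * (1 / real b ^ 2)) + 2 * Y * (1 / real k * (1 / real b)))"
      \<comment> \<open>If \<open>b > y\<close>, no \<open>m \<ge> b\<close> is in range, and the
        right-hand side is nonnegative.\<close>
      proof (cases "real b \<le> y")
        case False
        then have "U (k, b) = {}" by (auto simp: U_def y_def)
        then show ?thesis using x Y0 ln4x by simp
      next
        case True
        have yx: "y \<le> x" using kb x unfolding y_def
          by (simp add: divide_le_eq mult_le_cancel_left1 Suc_le_eq flip: of_nat_mult)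
        have y1: "y \<ge> 1" using True kb by simp
        have "(\<Sum>m\<in>U (k, b). F (k, b, m)) =
            (\<Sum>m\<in>{m. b \<le> m \<and> real m \<le> y}. sigma_inv (4 * (k * b) * m - 1) * div_ln (y / real m))"
          by (simp add: U_def F_def y_def)
        also have "\<dots> \<le> y * ((1 + ln (real W)) / real b + 2 * (1 + 2 * ln (1 + ln y)))"
        proof (rule sum_sigma_inv_div_ln_le)
          fix m assume "real m \<le> y"
          then have "real (4 * (k * b) * m) \<le> 4 * x" using kb by (simp add: y_def le_divide_eq mult_ac)
          then show "4 * (k * b) * m \<le> W" unfolding W_def by (rule le_nat_floor)
        qed (use kb True W in auto)
        also have "\<dots> \<le> y * ((1 + ln (4 * x)) / real b + 2 * Y)"
        proof -
          have "ln (real W) \<le> ln (4 * x)" using W x by (subst ln_le_cancel_iff) auto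
          moreover have "ln (1 + ln y) \<le> ln (1 + ln x)"
            using yx y1 ln_ge_zero[of y] by (subst ln_le_cancel_iff) (auto simp: add_pos_nonneg)
          ultimately show ?thesis
            using y1 unfolding Y_def by (intro mult_left_mono add_mono divide_right_mono) auto
        qed
        also have "\<dots> = x * ((1 + ln (4 * x)) * (1 / real k * (1 / real b ^ 2)) +
            2 * Y * (1 / real k * (1 / real b)))"
          using kb by (simp add: y_def power2_eq_square divide_simps)
        finally show ?thesis .
      qed
    qed
    finally show ?thesis .
  qed
  also have "\<dots> = x * ((1 + ln (4 * x)) * ((\<Sum>k=1..X. 1 / real k) * (\<Sum>b=1..X. 1 / real b ^ 2)) +
      2 * Y * ((\<Sum>k=1..X. 1 / real k) * (\<Sum>b=1..X. 1 / real b)))"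
  proof -
    have prod_sum: "(\<Sum>k=1..X. 1 / real k) * (\<Sum>b=1..X. g b) =
        (\<Sum>v\<in>{1..X} \<times> {1..X}. 1 / real (fst v) * g (snd v))" for g :: "nat \<Rightarrow> real"
      unfolding sum_product sum.cartesian_product by (simp add: split_beta)
    show ?thesis
      unfolding prod_sum by (simp only: case_prod_unfold sum_distrib_left distrib_left sum.distrib)
  qed
  also have "\<dots> \<le> x * ((1 + ln (4 * x)) * ((1 + ln x) * 2) + 2 * Y * ((1 + ln x) * (1 + ln x)))"
  proof -
    have "(\<Sum>k=1..X. 1 / real k) \<le> 1 + ln (real X)" by (rule sum_inverse_le) (rule X)
    also have "\<dots> \<le> 1 + ln x" using X x by simp
    finally have s1: "(\<Sum>k=1..X. 1 / real k) \<le> 1 + ln x" .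
    have s2: "(\<Sum>b=1..X. 1 / real b ^ 2) \<le> 2" by (rule sum_inverse_squares_le) auto
    have "Y \<ge> 0" "ln (4 * x) \<ge> 0" using lnx x by (auto simp: Y_def)
    then show ?thesis
      using s1 s2 x lnx by (intro mult_left_mono add_mono mult_mono sum_nonneg mult_nonneg_nonneg) auto
  qed
  finally show ?thesis unfolding F_def Y_def by (simp add: power2_eq_square algebra_simps)
qed

section \<open>Assembly of the estimates and the explicit constants\<close>

theorem mainTheorem1:
  shows "\<exists>C x0. C > 0 \<and> x0 > 0 \<and> (\<forall>x::real. x \<ge> x0 \<longrightarrow>
     (\<Sum>p | prime p \<and> real p < x. real (f2 p)) \<le> C * x * (ln x)^2 * ln (ln x))"
proof (intro exI conjI allI impI)
  \<comment> \<open>The constant is \<open>6 * 36 * 2 * 52\<close>: permutations, sieve bound,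
    symmetry in \<open>b\<close> and \<open>m\<close>, and the final numerical estimate. The
    threshold ensures \<open>ln (ln x) \<ge> 1\<close>.\<close>
  show "(22464::real) > 0" "exp (exp 1) > (0::real)" by simp_all
next
  fix x :: real assume x: "x \<ge> exp (exp 1)"
  define l where "l = ln x"
  have "exp (1::real) \<ge> 2" using exp_ge_add_one_self[of 1] by simp
  moreover have x_pos: "x > 0" using x exp_gt_zero less_le_trans by blast
  moreover have "l \<ge> exp 1" using x x_pos by (simp add: l_def ln_ge_iff)
  moreover from this have "ln l \<ge> 1"
    by (subst ln_ge_iff) (auto intro: less_le_trans[OF exp_gt_zero])
  ultimately have l: "l \<ge> 2" "ln l \<ge> 1" by simp_all
  have x1: "x \<ge> 1" using x exp_ge_add_one_self[of "exp 1"] exp_gt_zero[of "1::real"] by linarith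
  define X where "X = nat \<lfloor>x\<rfloor>"
  define Tri where "Tri = {(k, b, m). k \<in> {1..X} \<and> b \<in> {1..X} \<and> m \<in> {1..X} \<and> real (k * b * m) \<le> x}"
  have "(\<Sum>p | prime p \<and> real p < x. f2 p) \<le> (\<Sum>p | prime p \<and> real p < x. 6 * card (param_set p))"
    by (rule sum_mono) (use f2_le_card_param_set in auto)
  also have "\<dots> = 6 * (\<Sum>p | prime p \<and> real p < x. card (param_set p))"
    by (simp only: sum_distrib_left)
  also have "\<dots> \<le> 6 * (\<Sum>(k, b, m)\<in>Tri. card (param_count k b m (x / real (k * b * m))))"
    unfolding Tri_def X_def by (intro mult_left_mono sum_card_param_set_le) simp
  finally have "(\<Sum>p | prime p \<and> real p < x. real (f2 p)) \<le>
      6 * (\<Sum>(k, b, m)\<in>Tri. real (card (param_count k b m (x / real (k * b * m)))))"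
    by (simp add: split_beta flip: of_nat_sum of_nat_mult)
  also have "\<dots> \<le> 6 * (\<Sum>(k, b, m)\<in>Tri.
      36 * (sigma_inv (4 * (k * b) * m - 1) * div_ln (x / real (k * b * m))))"
  proof (intro mult_left_mono sum_mono, clarify)
    fix k b m assume "(k, b, m) \<in> Tri"
    then show "real (card (param_count k b m (x / real (k * b * m)))) \<le>
        36 * (sigma_inv (4 * (k * b) * m - 1) * div_ln (x / real (k * b * m)))"
      by (intro card_param_count_le) (auto simp: Tri_def le_divide_eq)
  qed simp
  also have "\<dots> = 216 * (\<Sum>(k, b, m)\<in>Tri. sigma_inv (4 * (k * b) * m - 1) * div_ln (x / real (k * b * m)))"
    by (simp add: sum_distrib_left split_beta)
  also have "\<dots> \<le> 216 * (2 * x * (2 * (1 + ln (4 * x)) * (1 + l) + 2 * (1 + 2 * ln (1 + l)) * (1 + l)\<^sup>2))"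
    unfolding Tri_def X_def l_def by (intro mult_left_mono sum_triples_le x1) simp
  also have "\<dots> \<le> 216 * (2 * x * (2 * (3 * l) * (2 * l) + 2 * (5 * ln l) * (2 * l)\<^sup>2))"
  proof -
    \<comment> \<open>All additive constants are absorbed using \<open>l \<ge> 2\<close> and
      \<open>ln l \<ge> 1\<close>.\<close>
    have "ln 4 \<le> (3::real)" using ln_le_minus_one[of 4] by simp
    then have "1 + ln (4 * x) \<le> 3 * l" using x_pos l(1) by (simp add: ln_mult l_def)
    moreover have "1 + 2 * ln (1 + l) \<le> 5 * ln l"
    proof -
      have "ln (1 + l) \<le> ln (2 * l)" using l(1) by simp
      also have "\<dots> = ln 2 + ln l" using l(1) by (simp add: ln_mult)
      also have "ln 2 \<le> (1::real)" using ln_le_minus_one[of 2] by simp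
      finally show ?thesis using l(2) by simp
    qed
    moreover have "1 + l \<le> 2 * l" using l(1) by simp
    moreover have "ln (4 * x) \<ge> 0" using x1 by simp
    ultimately show ?thesis
      using x_pos l by (intro mult_left_mono add_mono mult_mono power_mono) auto
  qed
  also have "\<dots> = 432 * x * l\<^sup>2 * (12 + 40 * ln l)" by (simp add: power2_eq_square algebra_simps)
  also have "\<dots> \<le> 432 * x * l\<^sup>2 * (52 * ln l)"
    using x_pos l(2) by (intro mult_left_mono) auto
  finally show "(\<Sum>p | prime p \<and> real p < x. real (f2 p)) \<le> 22464 * x * (ln x)^2 * ln (ln x)"
    by (simp add: l_def)
qed

end
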